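(* Let $T\subset\mathbb R^d$ be a simplicial or box-type element, $p,k\in\mathbb N$, and let $v\in\mathcal P_p(T)$ be a polynomial of degree at most $p$. Set $\delta_T:=\max\{|\mathbf x|:\mathbf x\in\bar T\}$. Then, for each face $F$ of $T$, $$\int_Fv^2(\mathbf s)\,\mathrm e^{-|\mathbf s|^{2k}/(2k)}\,\mathrm d\mathbf s\le c_{\rm inv}(k,\delta_T)\frac{p^2}{h_T}\int_Tv^2(\mathbf x)\,\mathrm e^{-|\mathbf x|^{2k}/(2k)}\,\mathrm d\mathbf x,$$ with $$c_{\rm inv}(k,\delta_T):=\frac{M_T^F\,h_T\,\big((h_T+\delta_T)^{2k}+2p+6\big)^2}{4\rho_T\,p^2\,\min_\theta\sin\theta},$$ where $\theta$ denotes the angles of $T$ and $\rho_T$ the radius of the largest inscribed ball of $T$.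
   Context: $h_T=\operatorname{diam}(T)$. A box-type element is a linearly mapped hypercube. For a simplicial $T$ and a face $F$, $M_T^F$ is the number of non-overlapping subfaces $F_1,\dots,F_{M_T^F}$ whose union is $F$ and which are such that each $F_i$ is one base of an oblique prism $\underline T_i=\{\mathbf x_{F_i}+t\mathbf b_{F_i}:\mathbf x_{F_i}\in F_i,\ t\in(0,1)\}\subset T$, with $\mathbf b_{F_i}\in\mathbb R^d$, whose second base lies in the section of $T$ parallel to $F$ at half the height of $T$ over $F$ (for $d=2$, $M_T^F=2$, the two halves of $F$; for $d=3$, $M_T^F=7$: the three corner triangles of the midpoint subdivision of $F$ together with the four triangles of the midpoint subdivision of its central triangle). A box-type $T$ is itself such a prism with base $F$, and $M_T^F=1$. The angles $\theta$ of $T$ are understood to include the angles between the axes $\mathbf b_{F_i}$ and the hyperplane of $F_i$; so $|\hat F_i|/|F_i|\ge\min_\theta\sin\theta$, where $\hat F_i$ is the base of the right-angle prism with the same axis $\mathbf b_{F_i}$ obtained from $\underline T_i$ by a shear transformation and $|\cdot|$ is $(d-1)$-dimensional volume. *)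

theory Defs
  imports "HOL-Analysis.Analysis"
begin

text \<open>
  Elements are taken to be closed sets. A face of an element means a facet, i.e. a face of
  codimension one (\<^const>\<open>facet_of\<close>).
\<close>

definition simplicial_element :: "(real^'n) set \<Rightarrow> bool" where
  "simplicial_element T \<longleftrightarrow> int CARD('n) simplex T"

definition box_element :: "(real^'n) set \<Rightarrow> bool" where
  "box_element T \<longleftrightarrow>
     (\<exists>a L. linear L \<and> inj L \<and> T = (\<lambda>x. a + L x) ` cbox (0::real^'n) One)"

definition inradius :: "(real^'n) set \<Rightarrow> real" where
  "inradius T = Sup {r. 0 \<le> r \<and> (\<exists>c. cball c r \<subseteq> T)}"

definition poly_on :: "nat \<Rightarrow> (real^'n) set \<Rightarrow> ((real^'n) \<Rightarrow> real) \<Rightarrow> bool" where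
  "poly_on p T v \<longleftrightarrow>
     (\<exists>c :: ('n \<Rightarrow> nat) \<Rightarrow> real. \<forall>x\<in>T.
        v x = (\<Sum>\<alpha> | (\<Sum>i\<in>UNIV. \<alpha> i) \<le> p. c \<alpha> * (\<Prod>i\<in>UNIV. (x $ i) ^ \<alpha> i)))"

definition direction_space :: "'a::euclidean_space set \<Rightarrow> 'a set" where
  "direction_space F = span {x - y |x y. x \<in> F \<and> y \<in> F}"

definition direction_onb :: "'a::euclidean_space set \<Rightarrow> 'a set" where
  "direction_onb F =
     (SOME B. pairwise orthogonal B \<and> (\<forall>e\<in>B. norm e = 1) \<and> span B = direction_space F)"

text \<open>
  The surface measure on the affine hull of a nonempty \<open>F\<close> is the image of product Lebesgue
  measure under an isometric parametrisation \<open>y \<mapsto> a + (\<Sum>e\<in>B. y e *\<^sub>R e)\<close> of that affine hull, with \<open>a \<in> F\<close>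
  and \<open>B\<close> an orthonormal basis of its direction space; it does not depend on the choice
  of \<open>a\<close> and \<open>B\<close>. If \<open>F\<close> is a single point, it is the unit point mass at that point.
\<close>

definition surface_measure :: "'a::euclidean_space set \<Rightarrow> 'a measure" where
  "surface_measure F =
     distr (\<Pi>\<^sub>M e\<in>direction_onb F. (lborel :: real measure)) borel
       (\<lambda>y. (SOME a. a \<in> F) + (\<Sum>e\<in>direction_onb F. y e *\<^sub>R e))"

definition oblique_prism :: "(real^'n) set \<Rightarrow> real^'n \<Rightarrow> (real^'n) set" where
  "oblique_prism G b = {x + t *\<^sub>R b |x t. x \<in> G \<and> 0 < t \<and> t < 1}"

definition height_over :: "(real^'n) set \<Rightarrow> (real^'n) set \<Rightarrow> real" where
  "height_over T F = (SUP x\<in>T. infdist x (affine hull F))"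

definition mid_section :: "(real^'n) set \<Rightarrow> (real^'n) set \<Rightarrow> (real^'n) set" where
  "mid_section T F = {x \<in> T. infdist x (affine hull F) = height_over T F / 2}"

text \<open>
  \<open>G 0, \<dots>, G (M - 1)\<close> are the subfaces of the face \<open>F\<close> of \<open>T\<close> and \<open>b 0, \<dots>, b (M - 1)\<close> the axes of
  the prisms over them; \<open>M\<close> is the number \<open>M\<^sub>T\<^sup>F\<close> belonging to this decomposition.
\<close>

definition simplex_prisms ::
    "(real^'n) set \<Rightarrow> (real^'n) set \<Rightarrow> nat \<Rightarrow> (nat \<Rightarrow> (real^'n) set) \<Rightarrow> (nat \<Rightarrow> real^'n) \<Rightarrow> bool" where
  "simplex_prisms T F M G b \<longleftrightarrow>
     F = (\<Union>i<M. G i) \<and>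
     (\<forall>i<M. polytope (G i) \<and> aff_dim (G i) = aff_dim F) \<and>
     (\<forall>i<M. \<forall>j<M. i \<noteq> j \<longrightarrow> rel_interior (G i) \<inter> rel_interior (G j) = {}) \<and>
     (\<forall>i<M. oblique_prism (G i) (b i) \<subseteq> T \<and> (\<lambda>x. x + b i) ` G i \<subseteq> mid_section T F)"

definition box_prism ::
    "(real^'n) set \<Rightarrow> (real^'n) set \<Rightarrow> nat \<Rightarrow> (nat \<Rightarrow> (real^'n) set) \<Rightarrow> (nat \<Rightarrow> real^'n) \<Rightarrow> bool" where
  "box_prism T F M G b \<longleftrightarrow> M = 1 \<and> G 0 = F \<and> T = closure (oblique_prism F (b 0))"

definition outward_normal :: "(real^'n) set \<Rightarrow> (real^'n) set \<Rightarrow> real^'n \<Rightarrow> bool" where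
  "outward_normal T F n \<longleftrightarrow> norm n = 1 \<and> (\<forall>x\<in>F. \<forall>y\<in>T. n \<bullet> y \<le> n \<bullet> x)"

text \<open>
  Interior angles between adjacent facets, i.e. facets meeting in a common face of codimension
  two (parallel facets of a box-type element form no angle). In the plane these are the interior
  angles at the vertices.
\<close>

definition dihedral_angles :: "(real^'n) set \<Rightarrow> real set" where
  "dihedral_angles T =
     {pi - arccos (n1 \<bullet> n2) |n1 n2.
        \<exists>F1 F2. F1 facet_of T \<and> F2 facet_of T \<and> (F1 \<inter> F2) facet_of F1 \<and>
                outward_normal T F1 n1 \<and> outward_normal T F2 n2}"

text \<open>Angles between the prism axes and the hyperplane of \<open>F\<close>, which has unit normal \<open>n\<close>.\<close>

definition axis_angles ::
    "(real^'n) set \<Rightarrow> (real^'n) set \<Rightarrow> nat \<Rightarrow> (nat \<Rightarrow> real^'n) \<Rightarrow> real set" where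
  "axis_angles T F M b =
     {arcsin (\<bar>b i \<bullet> n\<bar> / norm (b i)) |i n. i < M \<and> outward_normal T F n}"

definition element_angles ::
    "(real^'n) set \<Rightarrow> (real^'n) set \<Rightarrow> nat \<Rightarrow> (nat \<Rightarrow> real^'n) \<Rightarrow> real set" where
  "element_angles T F M b = dihedral_angles T \<union> axis_angles T F M b"

definition max_norm :: "(real^'n) set \<Rightarrow> real" where
  "max_norm T = (SUP x\<in>closure T. norm x)"

definition c_inv ::
    "(real^'n) set \<Rightarrow> (real^'n) set \<Rightarrow> nat \<Rightarrow> (nat \<Rightarrow> real^'n) \<Rightarrow> nat \<Rightarrow> nat \<Rightarrow> real \<Rightarrow> real" where
  "c_inv T F M b p k \<delta> =
     real M * diameter T * ((diameter T + \<delta>) ^ (2 * k) + 2 * real p + 6)\<^sup>2 /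
       (4 * inradius T * (real p)\<^sup>2 * Min (sin ` element_angles T F M b))"

definition weight :: "nat \<Rightarrow> real^'n \<Rightarrow> real" where
  "weight k x = exp (- (norm x ^ (2 * k)) / (2 * real k))"

end

theory Submission
  imports Defs
begin

text \<open>
  Along an axis \<open>b\<close> the exponent of the weight is convex, so it grows by at most \<open>t \<delta>\<^bsup>2k\<^esup> / (2 k)\<close> from
  \<open>s\<close> to \<open>s + t b\<close>. Multiplying \<open>v\<close> by \<open>(1 - t)\<^sup>m\<close> with \<open>2 m \<ge> \<delta>\<^bsup>2k\<^esup>\<close> therefore removes the weight at
  the price of raising the degree to \<open>p + m\<close>, and the sharp inequality
  \<open>w(0)\<^sup>2 \<le> (N + 1)\<^sup>2 \<integral> w\<^sup>2\<close> over \<open>(0, 1)\<close> for polynomials of degree \<open>N\<close> bounds the trace at \<open>s\<close> by the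
  integral over the segment. Integrating over a subface \<open>G i\<close> gives the integral over the prism
  divided by \<open>\<bar>b i \<bullet> n\<bar>\<close>. For a simplex \<open>\<bar>b i \<bullet> n\<bar>\<close> is half the height over \<open>F\<close>, for a box the full
  height, so it is at least the inradius in both cases. Each prism lies in \<open>T\<close>, and the \<open>M\<close>
  contributions are added up.
\<close>

subsection \<open>The inverse trace inequality on a segment\<close>

text \<open>The right-hand side is a rational function of \<open>x\<close> with a numerator of
  degree \<open>n\<close> and the \<open>n + 1\<close> simple poles -1, ..., -(n + 1), so it has a
  partial fraction decomposition. The residue at -1 is (n + 1)! / n! = n + 1. The induction
  multiplies by one more linear factor over one more pole.\<close>

lemma partial_fraction_coefficients:
  "\<exists>r::nat \<Rightarrow> real. r 0 = real (n + 1) \<and>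
     (\<forall>x::nat. (\<Sum>j\<le>n. r j / real (x + j + 1)) =
        (\<Prod>j=1..n. real j - real x) / (\<Prod>j\<le>n. real (x + j + 1)))"
proof (induction n)
  case 0
  show ?case by (rule exI[of _ "\<lambda>_. 1"]) simp
next
  case (Suc n)
  then obtain r where r0: "r 0 = real (n + 1)" and
    r: "\<And>x::nat. (\<Sum>j\<le>n. r j / real (x + j + 1)) =
        (\<Prod>j=1..n. real j - real x) / (\<Prod>j\<le>n. real (x + j + 1))"
    by blast
  \<comment> \<open>The new factor (n + 1 - x) / (x + n + 2) takes the value (n + j + 2) / (n + 1 -
    j) at the old pole x = -(j + 1), so \<open>a j\<close> is the updated residue there. The residue
    at the new pole collects the terms -(a j + r j), as the behaviour for large \<open>x\<close>
    forces.\<close>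
  define a where "a j = r j * real (n + j + 2) / real (n + 1 - j)" for j
  define r' where "r' j = (if j \<le> n then a j else - (\<Sum>j\<le>n. a j + r j))" for j
  have split: "r j / real (x + j + 1) * ((real (n + 1) - real x) / real (x + n + 2))
     = a j / real (x + j + 1) - (a j + r j) / real (x + n + 2)" if "j \<le> n" for j x
  proof -
    define X Y E where "X = real (x + j + 1)" and "Y = real (x + n + 2)" and "E = real (n + j + 2)"
    have pos: "X \<noteq> 0" "Y \<noteq> 0" "Y - X \<noteq> 0" and aj: "a j = r j * E / (Y - X)"
      and num: "real (n + 1) - real x = E - X"
      using that by (auto simp: X_def Y_def E_def a_def of_nat_diff)
    define C where "C = r j * E / (Y - X)"
    have "C / X - C / Y = C * (Y - X) / (X * Y)"
      using pos by (simp add: divide_simps algebra_simps)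
    also have "C * (Y - X) = r j * E" using pos by (simp add: C_def)
    finally have "C / X - C / Y = r j * E / (X * Y)" .
    moreover have "r j / X * ((E - X) / Y) = r j * E / (X * Y) - r j / Y"
      using pos by (simp add: field_simps)
    ultimately show ?thesis
      unfolding num aj C_def[symmetric] X_def[symmetric] Y_def[symmetric] by (simp add: add_divide_distrib)
  qed
  show ?case
  proof (intro exI[of _ r'] conjI allI)
    show "r' 0 = real (Suc n + 1)" by (simp add: r'_def a_def r0)
    fix x :: nat
    have "(\<Sum>j\<le>Suc n. r' j / real (x + j + 1))
       = (\<Sum>j\<le>n. a j / real (x + j + 1)) - (\<Sum>j\<le>n. (a j + r j) / real (x + n + 2))"
      by (simp add: r'_def sum.distrib sum_divide_distrib[symmetric] diff_divide_distrib add_divide_distrib)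
    also have "\<dots> = (\<Sum>j\<le>n. r j / real (x + j + 1) * ((real (n + 1) - real x) / real (x + n + 2)))"
      by (simp only: sum_subtractf[symmetric]) (intro sum.cong refl split[symmetric], simp)
    also have "\<dots> = (\<Prod>j=1..Suc n. real j - real x) / (\<Prod>j\<le>Suc n. real (x + j + 1))"
      by (simp only: sum_distrib_right[symmetric] r) (simp add: mult.commute)
    finally show "(\<Sum>j\<le>Suc n. r' j / real (x + j + 1))
       = (\<Prod>j=1..Suc n. real j - real x) / (\<Prod>j\<le>Suc n. real (x + j + 1))" .
  qed
qed

text \<open>
  The numbers \<open>r 0, \<dots>, r n\<close> form the first column of the inverse Hilbert matrix, so the polynomial with
  these coefficients represents evaluation at \<open>0\<close> in \<open>L\<^sup>2(0, 1)\<close> on polynomials of degree at most \<open>n\<close>.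
\<close>

lemma hilbert_matrix_kernel:
  obtains r :: "nat \<Rightarrow> real" where "r 0 = real ((n + 1)\<^sup>2)"
    "\<And>i. i \<le> n \<Longrightarrow> (\<Sum>j\<le>n. r j / real (i + j + 1)) = (if i = 0 then 1 else 0)"
proof -
  obtain r where r0: "r 0 = real (n + 1)" and
    r: "\<And>x::nat. (\<Sum>j\<le>n. r j / real (x + j + 1)) =
        (\<Prod>j=1..n. real j - real x) / (\<Prod>j\<le>n. real (x + j + 1))"
    using partial_fraction_coefficients by blast
  \<comment> \<open>At i = 0 the quotient is n! / (n + 1)!, so the factor n + 1 normalises the value
    to 1. For 1 \<le> i \<le> n the numerator contains the factor i - i.\<close>
  have "(\<Sum>j\<le>n. (real (n + 1) * r j) / real (i + j + 1)) = (if i = 0 then 1 else 0)" if "i \<le> n" for i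
  proof -
    have "(\<Prod>j=1..n. real j) = fact n" by (simp add: fact_prod)
    moreover have "(\<Prod>j\<le>n. real (j + 1)) = fact (n + 1)"
      by (induction n) (simp_all add: algebra_simps)
    ultimately have *: "real (n + 1) * ((\<Prod>j=1..n. real j) / (\<Prod>j\<le>n. real (j + 1))) = 1"
      using fact_nonzero[of "n + 1", where 'a=real] by (simp add: field_simps del: fact_nonzero)
    have "i \<noteq> 0 \<Longrightarrow> (\<Prod>j=1..n. real j - real i) = 0"
      using that by (intro prod_zero) auto
    moreover have "(\<Sum>j\<le>n. (real (n + 1) * r j) / real (i + j + 1))
      = real (n + 1) * ((\<Prod>j=1..n. real j - real i) / (\<Prod>j\<le>n. real (i + j + 1)))"
      by (simp only: times_divide_eq_right[symmetric] sum_distrib_left[symmetric] r)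
    ultimately show ?thesis using * by (cases "i = 0") simp_all
  qed
  moreover have "real (n + 1) * r 0 = real ((n + 1)\<^sup>2)"
    by (simp only: r0 power2_eq_square of_nat_mult)
  ultimately show thesis by (rule that[of "\<lambda>j. real (n + 1) * r j", rotated])
qed

text \<open>The Hilbert matrix enters as the Gram matrix of the monomials: the integral of t^(i+j)
  over the unit interval is 1 / (i + j + 1).\<close>

lemma has_integral_poly_mult_01:
  fixes a r :: "nat \<Rightarrow> real"
  shows "((\<lambda>t. (\<Sum>i\<le>n. a i * t ^ i) * (\<Sum>j\<le>n. r j * t ^ j)) has_integral
    (\<Sum>i\<le>n. a i * (\<Sum>j\<le>n. r j / real (i + j + 1)))) {0..1}"
proof -
  have pow: "((\<lambda>t::real. t ^ k) has_integral 1 / real (k + 1)) {0..1}" for k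
  proof -
    have "((\<lambda>t::real. t ^ k) has_integral 1 ^ Suc k / real (Suc k) - 0 ^ Suc k / real (Suc k)) {0..1}"
    proof (rule fundamental_theorem_of_calculus)
      fix t :: real
      show "((\<lambda>t. t ^ Suc k / real (Suc k)) has_vector_derivative t ^ k) (at t within {0..1})"
        unfolding has_real_derivative_iff_has_vector_derivative[symmetric]
        using DERIV_cdivide[OF DERIV_pow[of "Suc k" t "{0..1}"], of "real (Suc k)"]
        by (simp del: power_Suc of_nat_Suc)
    qed simp
    then show ?thesis by simp
  qed
  have "((\<lambda>t. \<Sum>i\<le>n. \<Sum>j\<le>n. (a i * r j) * t ^ (i + j)) has_integral
    (\<Sum>i\<le>n. \<Sum>j\<le>n. (a i * r j) * (1 / real (i + j + 1)))) {0..1}"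
    by (intro has_integral_sum has_integral_mult_right pow) auto
  moreover have "(\<Sum>i\<le>n. \<Sum>j\<le>n. (a i * r j) * t ^ (i + j)) =
      (\<Sum>i\<le>n. a i * t ^ i) * (\<Sum>j\<le>n. r j * t ^ j)" for t
    unfolding sum_product by (intro sum.cong refl) (simp add: power_add)
  ultimately show ?thesis
    by (simp add: sum_distrib_left mult.assoc)
qed

text \<open>Cauchy-Schwarz against the kernel \<open>R\<close> of evaluation at 0: w(0) is the inner
  product of \<open>w\<close> and \<open>R\<close>, and the squared norm of \<open>R\<close> is R(0)
  = (n + 1)^2. Equality holds for w = R.\<close>

lemma polynomial_endpoint_bound:
  fixes w :: "real poly"
  assumes "degree w \<le> n"
  shows "(poly w 0)\<^sup>2 \<le> (real (n + 1))\<^sup>2 * integral {0..1} (\<lambda>t. (poly w t)\<^sup>2)"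
proof -
  obtain r :: "nat \<Rightarrow> real" where r0: "r 0 = real ((n + 1)\<^sup>2)"
    and r: "\<And>i. i \<le> n \<Longrightarrow> (\<Sum>j\<le>n. r j / real (i + j + 1)) = (if i = 0 then 1 else 0)"
    using hilbert_matrix_kernel[of n] by metis
  define W where "W t = (\<Sum>i\<le>n. coeff w i * t ^ i)" for t
  define R where "R t = (\<Sum>i\<le>n. r i * t ^ i)" for t
  have W: "poly w t = W t" for t
  proof -
    have "poly w t = (\<Sum>i\<le>degree w. coeff w i * t ^ i)" by (rule poly_altdef)
    also have "\<dots> = W t" unfolding W_def
      by (rule sum.mono_neutral_left) (use assms in \<open>auto simp: coeff_eq_0\<close>)
    finally show ?thesis .
  qed
  \<comment> \<open>Pairing with \<open>R\<close> leaves only the constant coefficient; this is used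
    for the coefficients of \<open>w\<close> and for those of \<open>R\<close> itself.\<close>
  have red: "(\<Sum>i\<le>n. c i * (\<Sum>j\<le>n. r j / real (i + j + 1))) = c 0" for c :: "nat \<Rightarrow> real"
  proof -
    have "(\<Sum>i\<le>n. c i * (\<Sum>j\<le>n. r j / real (i + j + 1))) = (\<Sum>i\<le>n. if i = 0 then c i else 0)"
      by (intro sum.cong refl) (use r in auto)
    then show ?thesis by (simp add: sum.delta)
  qed
  have WR: "((\<lambda>t. W t * R t) has_integral coeff w 0) {0..1}"
    using has_integral_poly_mult_01[of "coeff w" n r] red unfolding W_def R_def by metis
  have RR: "((\<lambda>t. R t * R t) has_integral r 0) {0..1}"
    using has_integral_poly_mult_01[of r n r] red[of r] unfolding R_def by metis
  have WW: "((\<lambda>t. W t * W t) has_integral integral {0..1} (\<lambda>t. W t * W t)) {0..1}"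
    unfolding W_def by (intro integrable_integral integrable_continuous_real continuous_intros)
  \<comment> \<open>The minimiser of the squared norm of W - l R; its nonnegativity at this
    \<open>l\<close> is the Cauchy-Schwarz inequality.\<close>
  define l where "l = coeff w 0 / r 0"
  have "((\<lambda>t. W t * W t - 2 * l * (W t * R t) + l * l * (R t * R t)) has_integral
     (integral {0..1} (\<lambda>t. W t * W t) - 2 * l * coeff w 0 + l * l * r 0)) {0..1}"
    by (intro has_integral_add has_integral_diff has_integral_mult_right WR RR WW)
  moreover have "0 \<le> W t * W t - 2 * l * (W t * R t) + l * l * (R t * R t)" for t
    using zero_le_square[of "W t - l * R t"] by (simp add: algebra_simps)
  ultimately have "0 \<le> integral {0..1} (\<lambda>t. W t * W t) - 2 * l * coeff w 0 + l * l * r 0"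
    by (rule has_integral_nonneg)
  moreover have pos: "r 0 > 0" by (simp add: r0)
  then have "l * r 0 = coeff w 0" by (simp add: l_def)
  then have "l * l * r 0 = l * coeff w 0" by (simp add: mult.assoc)
  ultimately have "l * coeff w 0 \<le> integral {0..1} (\<lambda>t. W t * W t)" by linarith
  then have "(coeff w 0)\<^sup>2 \<le> r 0 * integral {0..1} (\<lambda>t. W t * W t)"
    using pos by (simp add: l_def pos_divide_le_eq power2_eq_square mult.commute)
  then show ?thesis
    unfolding W[symmetric] r0 poly_0_coeff_0 power2_eq_square of_nat_mult .
qed

section \<open>Weighted traces along a segment\<close>

text \<open>A weight whose exponent grows at most with slope 2m is traded for \<open>m\<close> extra
  degrees. The multiplier has value 1 at t = 0, so the trace is unchanged.\<close>

lemma weighted_endpoint_bound: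
  fixes q :: "real poly" and \<phi> :: "real \<Rightarrow> real" and m p :: nat
  assumes "degree q \<le> p" and cont: "continuous_on {0..1} \<phi>"
    and \<phi>: "\<And>t. t \<in> {0..1} \<Longrightarrow> \<phi> t \<le> \<phi> 0 + 2 * real m * t"
  shows "(poly q 0)\<^sup>2 * exp (- \<phi> 0) \<le>
    (real (p + m + 1))\<^sup>2 * integral {0..1} (\<lambda>t. (poly q t)\<^sup>2 * exp (- \<phi> t))"
proof -
  \<comment> \<open>The factor \<open>(1 - t)\<^sup>m\<close> absorbs the weight, since \<open>(1 - t)\<^bsup>2m\<^esup> \<le> exp (- 2 m t)\<close>.\<close>
  let ?w = "q * [:1, -1:] ^ m"
  have "degree ?w \<le> p + m"
    using degree_mult_le[of q "[:1, -1:] ^ m"] degree_power_le[of "[:1, -1::real:]" m] assms(1) by simp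
  then have "(poly ?w 0)\<^sup>2 \<le> (real (p + m + 1))\<^sup>2 * integral {0..1} (\<lambda>t. (poly ?w t)\<^sup>2)"
    by (rule polynomial_endpoint_bound)
  then have "(poly q 0)\<^sup>2 * exp (- \<phi> 0) \<le>
      (real (p + m + 1))\<^sup>2 * integral {0..1} (\<lambda>t. (poly ?w t)\<^sup>2) * exp (- \<phi> 0)"
    by (intro mult_right_mono) (simp_all add: poly_power)
  also have "\<dots> = (real (p + m + 1))\<^sup>2 * integral {0..1} (\<lambda>t. (poly ?w t)\<^sup>2 * exp (- \<phi> 0))"
    by simp
  also have "\<dots> \<le> (real (p + m + 1))\<^sup>2 * integral {0..1} (\<lambda>t. (poly q t)\<^sup>2 * exp (- \<phi> t))"
  proof (intro mult_left_mono integral_le)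
    fix t :: real assume t: "t \<in> {0..1}"
    have "(1 - t) ^ (2 * m) \<le> exp (- t) ^ (2 * m)"
      using t exp_ge_add_one_self[of "- t"] by (intro power_mono) auto
    also have "\<dots> = exp (- (2 * real m * t))"
      by (simp add: exp_of_nat_mult[symmetric])
    also have "\<dots> \<le> exp (\<phi> 0 - \<phi> t)"
      using \<phi>[OF t] by simp
    finally have "(1 - t) ^ (2 * m) * exp (- \<phi> 0) \<le> exp (\<phi> 0 - \<phi> t) * exp (- \<phi> 0)"
      by (rule mult_right_mono) simp
    also have "\<dots> = exp (- \<phi> t)" by (simp flip: exp_add)
    finally have "(poly q t)\<^sup>2 * ((1 - t) ^ (2 * m) * exp (- \<phi> 0)) \<le> (poly q t)\<^sup>2 * exp (- \<phi> t)"
      by (intro mult_left_mono) auto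
    then show "(poly ?w t)\<^sup>2 * exp (- \<phi> 0) \<le> (poly q t)\<^sup>2 * exp (- \<phi> t)"
      by (simp add: poly_power power_mult_distrib power_mult[symmetric] mult_ac)
  qed (auto intro!: integrable_continuous_real continuous_intros cont)
  finally show ?thesis .
qed

text \<open>Each coordinate is affine in \<open>t\<close>, so a monomial with exponent
  \<open>\<alpha>\<close> becomes a product of linear factors of total degree at most the sum of
  \<open>\<alpha>\<close>.\<close>

lemma poly_on_line:
  fixes P :: "real^'n \<Rightarrow> real"
  assumes "\<And>x. P x = (\<Sum>\<alpha> | (\<Sum>i\<in>UNIV. \<alpha> i) \<le> p. c \<alpha> * (\<Prod>i\<in>UNIV. (x $ i) ^ \<alpha> i))"
  obtains q :: "real poly" where "degree q \<le> p" "\<And>t. poly q t = P (s + t *\<^sub>R b)"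
proof
  let ?q = "\<Sum>\<alpha> | (\<Sum>i\<in>UNIV. \<alpha> i) \<le> p. smult (c \<alpha>) (\<Prod>i\<in>UNIV. [:s $ i, b $ i:] ^ \<alpha> i)"
  show "degree ?q \<le> p"
  \<comment> \<open>Sums over infinite sets are 0 by convention, so the case split replaces a proof
    that there are finitely many multi-indices.\<close>
  proof (cases "finite {\<alpha>::'n \<Rightarrow> nat. (\<Sum>i\<in>UNIV. \<alpha> i) \<le> p}")
    case True
    show ?thesis
    proof (rule degree_sum_le[OF True])
      fix \<alpha> :: "'n \<Rightarrow> nat" assume "\<alpha> \<in> {\<alpha>. (\<Sum>i\<in>UNIV. \<alpha> i) \<le> p}"
      then have \<alpha>: "(\<Sum>i\<in>UNIV. \<alpha> i) \<le> p" by simp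
      have "degree (smult (c \<alpha>) (\<Prod>i\<in>UNIV. [:s $ i, b $ i:] ^ \<alpha> i))
          \<le> degree (\<Prod>i\<in>UNIV. [:s $ i, b $ i:] ^ \<alpha> i)"
        by (rule degree_smult_le)
      also have "\<dots> \<le> (\<Sum>i\<in>UNIV. degree ([:s $ i, b $ i:] ^ \<alpha> i))"
        using degree_prod_sum_le[of UNIV "\<lambda>i. [:s $ i, b $ i:] ^ \<alpha> i"] by (simp add: o_def)
      also have "\<dots> \<le> (\<Sum>i\<in>UNIV. \<alpha> i)"
      proof (rule sum_mono)
        fix i
        have "degree ([:s $ i, b $ i:] ^ \<alpha> i) \<le> degree [:s $ i, b $ i:] * \<alpha> i"
          by (rule degree_power_le)
        also have "\<dots> \<le> \<alpha> i" by simp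
        finally show "degree ([:s $ i, b $ i:] ^ \<alpha> i) \<le> \<alpha> i" .
      qed
      also note \<alpha>
      finally show "degree (smult (c \<alpha>) (\<Prod>i\<in>UNIV. [:s $ i, b $ i:] ^ \<alpha> i)) \<le> p" .
    qed
  qed simp
  show "poly ?q t = P (s + t *\<^sub>R b)" for t
    by (simp add: assms poly_sum poly_prod poly_power)
qed

lemma norm_power_line_le:
  fixes s b :: "'a::real_normed_vector"
  assumes "t \<in> {0..1}" "norm (s + b) \<le> \<delta>"
  shows "norm (s + t *\<^sub>R b) ^ (2 * k) \<le> norm s ^ (2 * k) + t * \<delta> ^ (2 * k)"
proof -
  have "s + t *\<^sub>R b = (1 - t) *\<^sub>R s + t *\<^sub>R (s + b)" by (simp add: algebra_simps)
  then have "norm (s + t *\<^sub>R b) \<le> (1 - t) * norm s + t * norm (s + b)"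
    using norm_triangle_ineq[of "(1 - t) *\<^sub>R s" "t *\<^sub>R (s + b)"] assms(1) by simp
  then have "norm (s + t *\<^sub>R b) ^ (2 * k) \<le> ((1 - t) * norm s + t * norm (s + b)) ^ (2 * k)"
    by (intro power_mono) auto
  also have "\<dots> \<le> (1 - t) * norm s ^ (2 * k) + t * norm (s + b) ^ (2 * k)"
    using convex_onD[OF convex_power_even[of "2 * k"], of t "norm s" "norm (s + b)"] assms(1) by simp
  \<comment> \<open>The weight 1 - t is relaxed to 1: the bound becomes the value at
    \<open>s\<close> plus a multiple of \<open>t\<close>, the form of growth that
    \<open>weighted_endpoint_bound\<close> asks for.\<close>
  also have "\<dots> \<le> 1 * norm s ^ (2 * k) + t * \<delta> ^ (2 * k)"
    using assms by (intro add_mono mult_right_mono mult_left_mono power_mono) auto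
  finally show ?thesis by simp
qed

text \<open>The conclusion uses nonnegative integrals so that it can be integrated over a subface
  and rearranged by Tonelli.\<close>

lemma weighted_trace_on_line:
  fixes P :: "real^'n \<Rightarrow> real"
  assumes P: "\<And>x. P x = (\<Sum>\<alpha> | (\<Sum>i\<in>UNIV. \<alpha> i) \<le> p. c \<alpha> * (\<Prod>i\<in>UNIV. (x $ i) ^ \<alpha> i))"
    and k: "1 \<le> k" and \<delta>: "norm (s + b) \<le> \<delta>" and m: "\<delta> ^ (2 * k) \<le> 2 * real m"
  shows "ennreal ((P s)\<^sup>2 * weight k s) \<le> ennreal ((real (p + m + 1))\<^sup>2) *
    (\<integral>\<^sup>+t\<in>{0..1}. ennreal ((P (s + t *\<^sub>R b))\<^sup>2 * weight k (s + t *\<^sub>R b)) \<partial>lborel)"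
proof -
  obtain q where q: "degree q \<le> p" "\<And>t. poly q t = P (s + t *\<^sub>R b)"
    using poly_on_line[OF P] by metis
  define \<phi> where "\<phi> t = norm (s + t *\<^sub>R b) ^ (2 * k) / (2 * real k)" for t
  have cont: "continuous_on A \<phi>" for A
    using k unfolding \<phi>_def by (auto intro!: continuous_intros)
  have w: "weight k (s + t *\<^sub>R b) = exp (- \<phi> t)" for t
    by (simp add: weight_def \<phi>_def)
  have "\<phi> t \<le> \<phi> 0 + 2 * real m * t" if t: "t \<in> {0..1}" for t
  proof -
    have "norm (s + t *\<^sub>R b) ^ (2 * k) \<le> norm s ^ (2 * k) + t * (2 * real m)"
      using norm_power_line_le[OF t \<delta>, of k] mult_left_mono[OF m, of t] t by simp
    then have "\<phi> t \<le> (norm s ^ (2 * k) + t * (2 * real m)) / (2 * real k)"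
      unfolding \<phi>_def by (intro divide_right_mono) auto
    also have "\<dots> = \<phi> 0 + t * (2 * real m) / (2 * real k)"
      by (simp add: \<phi>_def add_divide_distrib)
    \<comment> \<open>The division by 2k in the exponent is bounded by division by 1, since k \<ge>
      1.\<close>
    also have "t * (2 * real m) / (2 * real k) \<le> t * (2 * real m) / 1"
      using k t by (intro divide_left_mono) auto
    finally show ?thesis by (simp add: mult_ac)
  qed
  from weighted_endpoint_bound[OF q(1) cont this]
  have *: "(P s)\<^sup>2 * weight k s \<le> (real (p + m + 1))\<^sup>2 *
      integral {0..1} (\<lambda>t. (P (s + t *\<^sub>R b))\<^sup>2 * weight k (s + t *\<^sub>R b))"
    using w[of 0] by (simp add: q(2) w)
  define g where "g t = (P (s + t *\<^sub>R b))\<^sup>2 * weight k (s + t *\<^sub>R b)" for t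
  have g: "continuous_on A g" for A
    unfolding g_def w by (auto simp: q(2)[symmetric] intro!: continuous_intros cont)
  have g0: "g t \<ge> 0" for t by (simp add: g_def weight_def)
  have "(\<integral>\<^sup>+t\<in>{0..1}. ennreal (g t) \<partial>lborel) = ennreal (integral {0..1} g)"
    by (intro nn_integral_has_integral_lebesgue' g0 integrable_integral integrable_continuous_real g)
  moreover have "ennreal ((P s)\<^sup>2 * weight k s) \<le> ennreal ((real (p + m + 1))\<^sup>2 * integral {0..1} g)"
    using * unfolding g_def by (rule ennreal_leI)
  ultimately show ?thesis
    by (simp add: g_def ennreal_mult')
qed

subsection \<open>Facets and normals of full-dimensional polytopes\<close>

lemma infdist_hyperplane:
  fixes n :: "'a::euclidean_space"
  assumes "norm n = 1"
  shows "infdist z {y. n \<bullet> y = c} = \<bar>n \<bullet> z - c\<bar>"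
proof (rule antisym)
  have nn: "n \<bullet> n = 1" using assms by (simp add: norm_eq_1)
  have "z - (n \<bullet> z - c) *\<^sub>R n \<in> {y. n \<bullet> y = c}"
    by (simp add: inner_diff_right nn)
  from infdist_le[OF this, of z] show "infdist z {y. n \<bullet> y = c} \<le> \<bar>n \<bullet> z - c\<bar>"
    by (simp add: dist_norm assms)
  have ne: "{y. n \<bullet> y = c} \<noteq> {}" using \<open>z - (n \<bullet> z - c) *\<^sub>R n \<in> _\<close> by blast
  show "\<bar>n \<bullet> z - c\<bar> \<le> infdist z {y. n \<bullet> y = c}"
    unfolding infdist_notempty[OF ne]
  proof (rule cINF_greatest[OF ne])
    fix y assume "y \<in> {y. n \<bullet> y = c}"
    then have "\<bar>n \<bullet> z - c\<bar> = \<bar>n \<bullet> (z - y)\<bar>" by (simp add: inner_diff_right)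
    also have "\<dots> \<le> norm n * norm (z - y)" by (rule Cauchy_Schwarz_ineq2)
    finally show "\<bar>n \<bullet> z - c\<bar> \<le> dist z y" by (simp add: assms dist_norm)
  qed
qed

text \<open>A ball in \<open>T\<close> contains z + r n and z - r n, so its diameter 2r fits into
  the width 2H of the slab.\<close>

lemma inradius_le:
  fixes T :: "(real^'n) set"
  assumes "norm n = 1" "T \<noteq> {}" and T: "\<And>y. y \<in> T \<Longrightarrow> c - 2 * H \<le> n \<bullet> y \<and> n \<bullet> y \<le> c"
  shows "inradius T \<le> H"
  unfolding inradius_def
proof (rule cSup_least)
  obtain x where "x \<in> T" using assms by blast
  then show "{r. 0 \<le> r \<and> (\<exists>c. cball c r \<subseteq> T)} \<noteq> {}"
    by (auto intro!: exI[of _ 0] exI[of _ x])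
  fix r assume "r \<in> {r. 0 \<le> r \<and> (\<exists>c. cball c r \<subseteq> T)}"
  then obtain z where "0 \<le> r" "cball z r \<subseteq> T" by blast
  moreover have "z + r *\<^sub>R n \<in> cball z r" "z - r *\<^sub>R n \<in> cball z r"
    using \<open>0 \<le> r\<close> assms(1) by (simp_all add: mem_cball dist_norm)
  moreover have "n \<bullet> n = 1" using assms by (simp add: norm_eq_1)
  ultimately have "n \<bullet> z + r \<le> c" "c - 2 * H \<le> n \<bullet> z - r"
    using T[of "z + r *\<^sub>R n"] T[of "z - r *\<^sub>R n"] by (simp_all add: inner_add_right inner_diff_right subset_iff)
  then show "r \<le> H" by simp
qed

text \<open>A real \<open>Sup\<close> dominates its members only for sets bounded above; here the
  bound is half the diameter of \<open>T\<close>.\<close>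

lemma inradius_pos:
  fixes T :: "(real^'n) set"
  assumes "bounded T" "interior T \<noteq> {}"
  shows "0 < inradius T"
proof -
  obtain z r where r: "0 < r" "cball z r \<subseteq> T"
    using assms(2) mem_interior_cball by blast
  have "r \<le> inradius T" unfolding inradius_def
  proof (rule cSup_upper)
    show "bdd_above {r. 0 \<le> r \<and> (\<exists>c. cball c r \<subseteq> T)}"
    proof (rule bdd_aboveI)
      fix r' assume "r' \<in> {r. 0 \<le> r \<and> (\<exists>c. cball c r \<subseteq> T)}"
      then obtain c where c: "0 \<le> r'" "cball c r' \<subseteq> T" by blast
      have "2 * r' = diameter (cball c r')" using c by simp
      also have "\<dots> \<le> diameter T" by (rule diameter_subset[OF c(2) assms(1)])
      finally show "r' \<le> diameter T / 2" by simp
    qed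
  qed (use r in auto)
  with r show ?thesis by simp
qed

section \<open>Elements as full-dimensional polytopes\<close>

lemma box_element_polytope:
  fixes T :: "(real^'n) set"
  assumes "box_element T"
  shows "polytope T" "aff_dim T = int CARD('n)"
proof -
  obtain a L where L: "linear L" "inj L" "T = (\<lambda>x. a + L x) ` cbox (0::real^'n) One"
    using assms unfolding box_element_def by blast
  then have T: "T = (+) a ` (L ` cbox 0 One)" by auto
  show "polytope T" unfolding T polytope_translation_eq
    by (intro polytope_linear_image polytope_interval L)
  have "interior (cbox (0::real^'n) One) \<noteq> {}"
    by (simp add: box_ne_empty inner_sum_left_Basis)
  then have "aff_dim (cbox (0::real^'n) One) = int CARD('n)"
    using aff_dim_nonempty_interior by fastforce
  then show "aff_dim T = int CARD('n)"
    unfolding T aff_dim_translation_eq by (simp only: aff_dim_injective_linear_image[OF L(1,2)])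
qed

lemma simplicial_element_polytope:
  fixes T :: "(real^'n) set"
  assumes "simplicial_element T"
  shows "polytope T" "aff_dim T = int CARD('n)"
  using assms simplex_imp_polytope aff_dim_simplex unfolding simplicial_element_def by auto

text \<open>Common setting for simplices and boxes: the facts on normals and angles are derived
  once, from convex geometry of full-dimensional polytopes.\<close>

locale element_facet =
  fixes T F :: "(real^'n) set"
  assumes polytope: "polytope T"
    and full_dim: "aff_dim T = int CARD('n)"
    and facet: "F facet_of T"
begin

lemma interior_nonempty: "interior T \<noteq> {}"
  using full_dim rel_interior_interior[of T] aff_dim_eq_full[of T]
    rel_interior_eq_empty[OF polytope_imp_convex[OF polytope]] by auto

lemma bounded: "bounded T"
  using polytope polytope_imp_bounded by blast

lemma closed: "closed T"
  using polytope polytope_imp_closed by blast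

lemma face_subset: "F \<subseteq> T"
  using facet facet_of_imp_subset by blast

lemma face_nonempty: "F \<noteq> {}"
  using facet facet_of_def by blast

text \<open>Faces of polyhedra are exposed; the supporting functional is normalised. It is nonzero,
  since otherwise \<open>F\<close> would be \<open>T\<close> or empty.\<close>

lemma outward_normal_exists: "\<exists>n. outward_normal T F n"
proof -
  have "F exposed_face_of T"
    using exposed_face_of_polyhedron polytope_imp_polyhedron[OF polytope] facet_of_imp_face_of[OF facet]
    by blast
  then obtain a c where ac: "T \<subseteq> {x. a \<bullet> x \<le> c}" "F = T \<inter> {x. a \<bullet> x = c}"
    unfolding exposed_face_of_def by blast
  have "a \<noteq> 0"
  proof
    assume "a = 0"
    then have "F = T \<or> F = {}" using ac by auto
    then show False using facet by (auto simp: facet_of_def)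
  qed
  then have "outward_normal T F (a /\<^sub>R norm a)"
    unfolding outward_normal_def
  proof (intro conjI ballI)
    fix x y assume "x \<in> F" "y \<in> T"
    then have "a \<bullet> y \<le> a \<bullet> x" using ac by auto
    then show "(a /\<^sub>R norm a) \<bullet> y \<le> (a /\<^sub>R norm a) \<bullet> x"
      by (simp add: mult_left_mono)
  qed simp
  then show ?thesis by blast
qed

lemma normal_const:
  assumes "outward_normal T F n" "x \<in> F" "y \<in> F"
  shows "n \<bullet> x = n \<bullet> y"
  using assms face_subset unfolding outward_normal_def by (meson antisym subsetD)

text \<open>The normal is constant on \<open>F\<close>, which gives one inclusion. Equality follows
  by dimension: a facet of a full-dimensional polytope has d - 1 independent differences.\<close>

lemma direction_space_hyperplane:
  assumes n: "outward_normal T F n"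
  shows "direction_space F = {x. n \<bullet> x = 0}"
proof (rule subspace_dim_equal)
  show "subspace (direction_space F)" "subspace {x. n \<bullet> x = 0}"
    by (simp_all add: direction_space_def subspace_hyperplane)
  show "direction_space F \<subseteq> {x. n \<bullet> x = 0}"
    unfolding direction_space_def
    by (rule span_minimal[OF _ subspace_hyperplane])
      (clarsimp simp: inner_diff_right, rule normal_const[OF n])
  obtain a where a: "a \<in> F" using face_nonempty by blast
  have "n \<noteq> 0" using n by (auto simp: outward_normal_def)
  then have "int (dim {x. n \<bullet> x = 0}) = int CARD('n) - 1"
    by (subst dim_hyperplane) (simp_all add: of_nat_diff Suc_leI)
  also have "\<dots> = aff_dim F" using facet full_dim by (simp add: facet_of_def)
  also have "\<dots> = int (dim ((\<lambda>x. x - a) ` F))"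
    using aff_dim_eq_dim_subtract[of a F] a hull_inc by fastforce
  also have "\<dots> \<le> int (dim (direction_space F))"
  proof -
    have "(\<lambda>x. x - a) ` F \<subseteq> direction_space F"
      unfolding direction_space_def using a by (auto intro!: span_base)
    then show ?thesis by (simp add: dim_subset)
  qed
  finally show "dim {x. n \<bullet> x = 0} \<le> dim (direction_space F)" by simp
qed

lemma affine_hull_face:
  assumes n: "outward_normal T F n" and x: "x \<in> F"
  shows "affine hull F = {y. n \<bullet> y = n \<bullet> x}"
proof (rule affine_dim_equal)
  show "affine {y. n \<bullet> y = n \<bullet> x}" by (rule affine_hyperplane)
  show "affine hull F \<subseteq> {y. n \<bullet> y = n \<bullet> x}"
    by (rule hull_minimal) (use normal_const[OF n _ x] affine_hyperplane in blast)+
  have "n \<noteq> 0" using n by (auto simp: outward_normal_def)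
  then show "aff_dim (affine hull F) = aff_dim {y. n \<bullet> y = n \<bullet> x}"
    using facet full_dim by (simp add: facet_of_def)
qed (use x in auto)

text \<open>Full dimension keeps \<open>T\<close> out of the supporting hyperplane. This is what
  rules out opposite normals below.\<close>

lemma normal_less:
  assumes "outward_normal T F n" "x \<in> F"
  obtains y where "y \<in> T" "n \<bullet> y < n \<bullet> x"
proof -
  have "\<not> T \<subseteq> {y. n \<bullet> y = n \<bullet> x}"
  proof
    assume "T \<subseteq> {y. n \<bullet> y = n \<bullet> x}"
    then have "aff_dim T \<le> aff_dim {y. n \<bullet> y = n \<bullet> x}" by (rule aff_dim_subset)
    moreover have "n \<noteq> 0" using assms by (auto simp: outward_normal_def)
    ultimately show False using full_dim by simp
  qed
  then show thesis using that assms unfolding outward_normal_def by force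
qed

lemma outward_normal_unique:
  assumes n: "outward_normal T F n" and n': "outward_normal T F n'"
  shows "n' = n"
proof -
  have nn: "n \<bullet> n = 1" "n' \<bullet> n' = 1" using n n' by (auto simp: outward_normal_def norm_eq_1)
  \<comment> \<open>The part of n' orthogonal to \<open>n\<close> lies in the direction space of
    \<open>F\<close>, hence is orthogonal to n' as well; pairing it with n' gives (n . n')^2 =
    1.\<close>
  have "n' - (n \<bullet> n') *\<^sub>R n \<in> {x. n \<bullet> x = 0}" by (simp add: inner_diff_right nn)
  then have "n' - (n \<bullet> n') *\<^sub>R n \<in> {x. n' \<bullet> x = 0}"
    using direction_space_hyperplane[OF n] direction_space_hyperplane[OF n'] by simp
  then have sq: "(n \<bullet> n') * (n \<bullet> n') = 1"
    by (simp add: inner_diff_right nn inner_commute)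
  have eq: "n' = (n \<bullet> n') *\<^sub>R n"
  proof -
    have "(n' - (n \<bullet> n') *\<^sub>R n) \<bullet> (n' - (n \<bullet> n') *\<^sub>R n) = 0"
      by (simp add: inner_diff_right inner_diff_left nn inner_commute sq)
    then show ?thesis by simp
  qed
  from sq have "n \<bullet> n' = 1 \<or> n \<bullet> n' = -1" by (simp add: square_eq_1_iff)
  moreover have "n \<bullet> n' \<noteq> -1"
  proof
    assume "n \<bullet> n' = -1"
    then have m: "n' = - n" using eq by simp
    obtain x where x: "x \<in> F" using face_nonempty by blast
    obtain y where "y \<in> T" "n \<bullet> y < n \<bullet> x" using normal_less[OF n x] .
    then show False using n' x unfolding m outward_normal_def by force
  qed
  ultimately show ?thesis using eq by simp
qed

text \<open>\<open>F\<close> is a face of the exposed set, whose dimension is at most d - 1; a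
  proper face would have strictly smaller dimension.\<close>

lemma face_eq_exposed:
  assumes n: "outward_normal T F n" and x: "x \<in> F"
  shows "F = T \<inter> {y. n \<bullet> y = n \<bullet> x}"
proof (rule ccontr)
  let ?E = "T \<inter> {y. n \<bullet> y = n \<bullet> x}"
  assume ne: "F \<noteq> ?E"
  have "F \<subseteq> ?E"
  proof
    fix y assume y: "y \<in> F"
    show "y \<in> ?E" using normal_const[OF n y x] face_subset y by blast
  qed
  then have "F face_of ?E"
    by (rule face_of_subset[OF facet_of_imp_face_of[OF facet]]) simp
  moreover have "convex ?E"
    using polytope_imp_convex[OF polytope] by (intro convex_Int convex_hyperplane)
  ultimately have "aff_dim F < aff_dim ?E"
    using ne by (simp add: face_of_aff_dim_lt)
  also have "\<dots> \<le> aff_dim {y. n \<bullet> y = n \<bullet> x}" by (rule aff_dim_subset) simp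
  also have "\<dots> = int CARD('n) - 1"
    using n by (subst aff_dim_hyperplane) (auto simp: outward_normal_def)
  finally show False using facet full_dim by (simp add: facet_of_def)
qed


section \<open>Prism axes and the inradius\<close>

lemma simplex_prisms_axis:
  assumes S: "simplex_prisms T F M G b" and i: "i < M" and n: "outward_normal T F n"
  shows "inradius T \<le> \<bar>b i \<bullet> n\<bar>"
proof -
  have "aff_dim (G i) = aff_dim F" using S i unfolding simplex_prisms_def by blast
  then have "G i \<noteq> {}" using face_nonempty aff_dim_empty by metis
  then obtain x where x: "x \<in> G i" by blast
  have xF: "x \<in> F" using S i x unfolding simplex_prisms_def by blast
  have nn: "norm n = 1" using n by (simp add: outward_normal_def)
  have dist: "infdist y (affine hull F) = \<bar>n \<bullet> y - n \<bullet> x\<bar>" for y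
    unfolding affine_hull_face[OF n xF] by (rule infdist_hyperplane[OF nn])
  have "x + b i \<in> mid_section T F" using S i x unfolding simplex_prisms_def by blast
  then have "infdist (x + b i) (affine hull F) = height_over T F / 2"
    by (simp add: mid_section_def)
  \<comment> \<open>The factor 2 reflects that the second base lies at half the height; the slab of
    this width containing \<open>T\<close> then bounds the inradius by
    \<open>\<bar>b i \<bullet> n\<bar>\<close>.\<close>
  then have height: "height_over T F = 2 * \<bar>b i \<bullet> n\<bar>"
    unfolding dist by (simp add: inner_add_right inner_commute)
  have "bdd_above ((\<lambda>y. infdist y (affine hull F)) ` T)"
    using polytope_imp_compact[OF polytope]
    by (intro bounded_imp_bdd_above compact_imp_bounded compact_continuous_image continuous_intros)
  then have "\<bar>n \<bullet> y - n \<bullet> x\<bar> \<le> 2 * \<bar>b i \<bullet> n\<bar>" if "y \<in> T" for y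
    using cSUP_upper[OF that, of "\<lambda>y. infdist y (affine hull F)"] height
    unfolding height_over_def dist by simp
  then have "n \<bullet> x - 2 * \<bar>b i \<bullet> n\<bar> \<le> n \<bullet> y \<and> n \<bullet> y \<le> n \<bullet> x" if "y \<in> T" for y
    using that n xF unfolding outward_normal_def by fastforce
  then show ?thesis
    using xF face_subset by (intro inradius_le[OF nn]) auto
qed

lemma box_prism_axis:
  assumes B: "box_prism T F M G b" and i: "i < M" and n: "outward_normal T F n"
  shows "inradius T \<le> \<bar>b i \<bullet> n\<bar>"
proof -
  obtain x where x: "x \<in> F" using face_nonempty by blast
  have i0: "i = 0" and T: "T = closure (oblique_prism F (b 0))"
    using B i unfolding box_prism_def by auto
  have nn: "norm n = 1" using n by (simp add: outward_normal_def)
  \<comment> \<open>The prism has width only \<open>\<bar>b i \<bullet> n\<bar>\<close> in direction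
    \<open>n\<close>; the doubled slab is taken to match \<open>inradius_le\<close>.\<close>
  have "oblique_prism F (b 0) \<subseteq> {y. n \<bullet> y \<ge> n \<bullet> x - 2 * \<bar>b i \<bullet> n\<bar>}"
  proof
    fix y assume "y \<in> oblique_prism F (b 0)"
    then obtain z t where z: "z \<in> F" "0 < t" "t < 1" "y = z + t *\<^sub>R b 0"
      unfolding oblique_prism_def by blast
    have "n \<bullet> y = n \<bullet> x + t * (b i \<bullet> n)"
      using normal_const[OF n z(1) x] by (simp add: z(4) inner_add_right i0 inner_commute)
    moreover have "\<bar>t * (b i \<bullet> n)\<bar> \<le> 1 * \<bar>b i \<bullet> n\<bar>"
      unfolding abs_mult using z by (intro mult_right_mono) auto
    ultimately show "y \<in> {y. n \<bullet> y \<ge> n \<bullet> x - 2 * \<bar>b i \<bullet> n\<bar>}" by simp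
  qed
  then have "T \<subseteq> {y. n \<bullet> y \<ge> n \<bullet> x - 2 * \<bar>b i \<bullet> n\<bar>}"
    unfolding T by (rule closure_minimal) (rule closed_halfspace_ge)
  then have "n \<bullet> x - 2 * \<bar>b i \<bullet> n\<bar> \<le> n \<bullet> y \<and> n \<bullet> y \<le> n \<bullet> x" if "y \<in> T" for y
    using that n x unfolding outward_normal_def by auto
  then show ?thesis
    using x face_subset by (intro inradius_le[OF nn]) auto
qed

text \<open>The prism has open parameter range, but \<open>T\<close> is closed. The endpoint t = 1
  is used for the norm bound at \<open>s + b\<close>.\<close>

lemma closed_prism_subset:
  assumes "oblique_prism H b \<subseteq> T" "s \<in> H" "t \<in> {0..1}"
  shows "s + t *\<^sub>R b \<in> T"
proof -
  have "(\<lambda>t. s + t *\<^sub>R b) ` closure {0<..<1} \<subseteq> T"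
  proof (rule image_closure_subset[OF _ closed])
    show "(\<lambda>t. s + t *\<^sub>R b) ` {0<..<1} \<subseteq> T"
      using assms(1,2) unfolding oblique_prism_def by fastforce
  qed (intro continuous_intros)
  then show ?thesis using assms(3) by (auto simp: image_subset_iff)
qed

section \<open>Angles of an element\<close>

text \<open>The sine vanishes only if n1 . n2 is 1 or -1. In the first case both facets are cut out
  of \<open>T\<close> by the same hyperplane through a common point and coincide, although their
  intersection is a facet of \<open>F1\<close>. In the second case \<open>T\<close> would lie in a
  hyperplane.\<close>

lemma dihedral_angle_sin_pos:
  assumes "\<theta> \<in> dihedral_angles T"
  shows "0 < sin \<theta>"
proof -
  obtain n1 n2 F1 F2 where \<theta>: "\<theta> = pi - arccos (n1 \<bullet> n2)"
    and F: "F1 facet_of T" "F2 facet_of T" "(F1 \<inter> F2) facet_of F1"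
    and n: "outward_normal T F1 n1" "outward_normal T F2 n2"
    using assms unfolding dihedral_angles_def by blast
  interpret F1: element_facet T F1 by unfold_locales (fact polytope full_dim F)+
  interpret F2: element_facet T F2 by unfold_locales (fact polytope full_dim F)+
  obtain x where x: "x \<in> F1" "x \<in> F2" using F(3) unfolding facet_of_def by blast
  have nn: "norm n1 = 1" "norm n2 = 1" using n by (auto simp: outward_normal_def)
  then have nn': "n1 \<bullet> n1 = 1" "n2 \<bullet> n2 = 1" by (simp_all add: norm_eq_1)
  have abs: "\<bar>n1 \<bullet> n2\<bar> \<le> 1" using Cauchy_Schwarz_ineq2[of n1 n2] nn by simp
  have "n1 \<bullet> n2 \<noteq> 1"
  proof
    assume "n1 \<bullet> n2 = 1"
    then have "(n1 - n2) \<bullet> (n1 - n2) = 0"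
      by (simp add: inner_diff_left inner_diff_right nn' inner_commute)
    then have "n1 = n2" by simp
    then have "F1 = F2" using F1.face_eq_exposed[OF n(1) x(1)] F2.face_eq_exposed[OF n(2) x(2)] by simp
    then show False using F(3) by simp
  qed
  moreover have "n1 \<bullet> n2 \<noteq> - 1"
  proof
    assume "n1 \<bullet> n2 = - 1"
    then have "(n1 + n2) \<bullet> (n1 + n2) = 0"
      by (simp add: inner_add_left inner_add_right nn' inner_commute)
    then have "n1 = - n2" by (simp add: eq_neg_iff_add_eq_0)
    moreover obtain y where "y \<in> T" "n1 \<bullet> y < n1 \<bullet> x" using F1.normal_less[OF n(1) x(1)] .
    ultimately show False using n(2) x unfolding outward_normal_def by force
  qed
  ultimately have "\<bar>n1 \<bullet> n2\<bar> < 1" using abs by linarith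
  then have "0 < sin (arccos (n1 \<bullet> n2))"
    by (intro sin_gt_zero arccos_lt_bounded[THEN conjunct1] arccos_lt_bounded[THEN conjunct2]) auto
  then show ?thesis unfolding \<theta> by simp
qed

lemma finite_facet_normals: "finite {n. \<exists>F'. F' facet_of T \<and> outward_normal T F' n}"
proof -
  have "{n. \<exists>F'. F' facet_of T \<and> outward_normal T F' n}
     = (\<Union>F'\<in>{F'. F' facet_of T}. {n. outward_normal T F' n})" by blast
  moreover have "finite {n. outward_normal T F' n}" if "F' facet_of T" for F'
  proof -
    interpret F': element_facet T F' by unfold_locales (fact polytope full_dim that)+
    obtain n where "outward_normal T F' n" using F'.outward_normal_exists by blast
    then have "{n. outward_normal T F' n} \<subseteq> {n}" using F'.outward_normal_unique by blast
    then show ?thesis using finite_subset by blast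
  qed
  ultimately show ?thesis using finite_polytope_facets[OF polytope] by simp
qed

text \<open>Finiteness makes \<open>Min\<close> in \<open>c_inv\<close> a true minimum. It rests on
  the finitely many facets, each with a single outward normal.\<close>

lemma finite_element_angles: "finite (element_angles T F M b)"
proof -
  let ?N = "{n. \<exists>F'. F' facet_of T \<and> outward_normal T F' n}"
  have "dihedral_angles T \<subseteq> (\<lambda>(n1, n2). pi - arccos (n1 \<bullet> n2)) ` (?N \<times> ?N)"
    unfolding dihedral_angles_def by force
  moreover have "axis_angles T F M b \<subseteq> (\<lambda>(i, n). arcsin (\<bar>b i \<bullet> n\<bar> / norm (b i))) ` ({..<M} \<times> ?N)"
    unfolding axis_angles_def using facet by force
  ultimately show ?thesis
    unfolding element_angles_def using finite_facet_normals
    by (meson finite_SigmaI finite_UnI finite_imageI finite_lessThan finite_subset)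
qed

text \<open>With these bounds, dividing by the minimum is legitimate and can only enlarge a
  nonnegative constant.\<close>

lemma Min_sin_angles:
  assumes "0 < M" and axis: "\<And>i n. i < M \<Longrightarrow> outward_normal T F n \<Longrightarrow> b i \<bullet> n \<noteq> 0"
  shows "0 < Min (sin ` element_angles T F M b)" "Min (sin ` element_angles T F M b) \<le> 1"
proof -
  obtain n where "outward_normal T F n" using outward_normal_exists by blast
  then have "arcsin (\<bar>b 0 \<bullet> n\<bar> / norm (b 0)) \<in> element_angles T F M b"
    using assms(1) unfolding element_angles_def axis_angles_def by blast
  then have ne: "element_angles T F M b \<noteq> {}" by blast
  have "0 < sin \<theta>" if \<theta>: "\<theta> \<in> axis_angles T F M b" for \<theta>
  proof -
    obtain i n where i: "i < M" "outward_normal T F n" "\<theta> = arcsin (\<bar>b i \<bullet> n\<bar> / norm (b i))"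
      using \<theta> unfolding axis_angles_def by blast
    have b: "b i \<bullet> n \<noteq> 0" using axis i by blast
    then have "b i \<noteq> 0" by auto
    moreover have "\<bar>b i \<bullet> n\<bar> \<le> norm (b i)"
      using Cauchy_Schwarz_ineq2[of "b i" n] i(2) by (simp add: outward_normal_def)
    ultimately show ?thesis using b unfolding i(3) by (simp add: divide_simps)
  qed
  then show "0 < Min (sin ` element_angles T F M b)"
    using finite_element_angles ne dihedral_angle_sin_pos
    by (subst Min_gr_iff) (auto simp: element_angles_def)
  have "Min (sin ` element_angles T F M b) \<in> sin ` element_angles T F M b"
    using finite_element_angles ne by (intro Min_in) auto
  then show "Min (sin ` element_angles T F M b) \<le> 1" by auto
qed

end

subsection \<open>Lebesgue measure in coordinates along a hyperplane and a transversal axis\<close>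

text \<open>Relabelling carries rectangles to rectangles with the same sides, and these determine
  the product measure. The relabelled point is restricted to \<open>B\<close> because points of a
  product space are extensional.\<close>

lemma nn_integral_PiM_reindex:
  fixes q :: "'i \<Rightarrow> 'j" and f :: "('j \<Rightarrow> real) \<Rightarrow> ennreal"
  assumes fin: "finite J" and q: "bij_betw q J B"
    and f[measurable]: "f \<in> borel_measurable (\<Pi>\<^sub>M e\<in>B. (lborel :: real measure))"
  shows "(\<integral>\<^sup>+y. f y \<partial>(\<Pi>\<^sub>M e\<in>B. (lborel :: real measure))) =
    (\<integral>\<^sup>+x. f (\<lambda>e\<in>B. x (the_inv_into J q e)) \<partial>(\<Pi>\<^sub>M j\<in>J. (lborel :: real measure)))"
proof -
  interpret product_sigma_finite "\<lambda>_::'j. lborel :: real measure" by unfold_locales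
  interpret J: product_sigma_finite "\<lambda>_::'i. lborel :: real measure" by unfold_locales
  let ?PJ = "\<Pi>\<^sub>M j\<in>J. (lborel :: real measure)" and ?PB = "\<Pi>\<^sub>M e\<in>B. (lborel :: real measure)"
  let ?r = "\<lambda>x. \<lambda>e\<in>B. x (the_inv_into J q e)"
  have inv: "the_inv_into J q e \<in> J" "q (the_inv_into J q e) = e" if "e \<in> B" for e
    using q that by (auto simp: bij_betw_def the_inv_into_into f_the_inv_into_f)
  have inv': "the_inv_into J q (q j) = j" "q j \<in> B" if "j \<in> J" for j
    using q that by (auto simp: bij_betw_def the_inv_into_f_f)
  have finB: "finite B" using fin q bij_betw_finite by blast
  have [measurable]: "?r \<in> measurable ?PJ ?PB"
    by (intro measurable_restrict measurable_component_singleton inv)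
  have "distr ?PJ ?PB ?r = ?PB"
  proof (rule PiM_eqI[OF finB])
    fix A :: "'j \<Rightarrow> real set" assume "\<And>e. e \<in> B \<Longrightarrow> A e \<in> sets lborel"
    then have A: "\<And>e. e \<in> B \<Longrightarrow> A e \<in> sets borel" by simp
    have "?r -` Pi\<^sub>E B A \<inter> space ?PJ = Pi\<^sub>E J (\<lambda>j. A (q j))"
    proof (intro set_eqI iffI)
      fix x assume x: "x \<in> ?r -` Pi\<^sub>E B A \<inter> space ?PJ"
      have "x j \<in> A (q j)" if "j \<in> J" for j
        using PiE_mem[of "?r x" B A "q j"] x inv'[OF that] by auto
      with x show "x \<in> Pi\<^sub>E J (\<lambda>j. A (q j))"
        by (auto simp: space_PiM PiE_iff)
    next
      fix x assume x: "x \<in> Pi\<^sub>E J (\<lambda>j. A (q j))"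
      have "x (the_inv_into J q e) \<in> A e" if "e \<in> B" for e
        using PiE_mem[OF x inv(1)[OF that]] inv(2)[OF that] by simp
      with x show "x \<in> ?r -` Pi\<^sub>E B A \<inter> space ?PJ"
        by (auto simp: space_PiM PiE_iff)
    qed
    then have "emeasure (distr ?PJ ?PB ?r) (Pi\<^sub>E B A) = emeasure ?PJ (Pi\<^sub>E J (\<lambda>j. A (q j)))"
      using A finB by (subst emeasure_distr) (auto intro!: sets_PiM_I_finite)
    also have "\<dots> = (\<Prod>j\<in>J. emeasure lborel (A (q j)))"
      using A fin inv' by (intro J.emeasure_PiM) auto
    also have "\<dots> = (\<Prod>e\<in>B. emeasure lborel (A e))"
      by (rule prod.reindex_bij_betw[OF q])
    finally show "emeasure (distr ?PJ ?PB ?r) (Pi\<^sub>E B A) = (\<Prod>e\<in>B. emeasure lborel (A e))" .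
  qed simp
  then have "(\<integral>\<^sup>+y. f y \<partial>?PB) = (\<integral>\<^sup>+y. f y \<partial>(distr ?PJ ?PB ?r))" by simp
  also have "\<dots> = (\<integral>\<^sup>+x. f (?r x) \<partial>?PJ)" by (rule nn_integral_distr) measurable
  finally show ?thesis .
qed

text \<open>Change of variables as an identity of measures, which extends it to all nonnegative
  Borel functions. It suffices to compare boxes, whose preimages are open and bounded, hence of
  finite measure.\<close>

lemma lborel_linear:
  fixes C :: "real^'m::{finite,wellorder}^'m::_"
  assumes det: "det C \<noteq> 0"
  shows "lborel = density (distr lborel borel ((*v) C)) (\<lambda>_. ennreal \<bar>det C\<bar>)"
proof (rule lborel_eqI)
  have inj1: "inj ((*v) C)"
    using det invertible_det_nz by (auto simp: invertible_left_inverse matrix_left_invertible_injective)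
  then have inj: "inj ((*v) C)" "surj ((*v) C)"
    using linear_injective_imp_surjective[OF matrix_vector_mul_linear inj1] by simp_all
  have [measurable]: "(*v) C \<in> borel \<rightarrow>\<^sub>M borel"
    by (intro borel_measurable_continuous_onI linear_continuous_on matrix_vector_mul_bounded_linear)
  fix l u :: "real^'m::_" assume lu: "\<And>b. b \<in> Basis \<Longrightarrow> l \<bullet> b \<le> u \<bullet> b"
  define S where "S = (*v) C -` box l u"
  have CS: "(*v) C ` S = box l u" using inj(2) by (auto simp: S_def surj_image_vimage_eq)
  have "open S" unfolding S_def
    by (intro open_vimage open_box linear_continuous_on matrix_vector_mul_bounded_linear)
  have "bounded S"
  proof -
    obtain g where g: "linear g" "g \<circ> (*v) C = id"
      using linear_injective_left_inverse[OF matrix_vector_mul_linear inj(1)] by blast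
    have "S = g ` box l u" unfolding CS[symmetric] image_comp g(2) by simp
    then show ?thesis using bounded_linear_image[OF bounded_box] g(1) linear_conv_bounded_linear by blast
  qed
  have S: "S \<in> lmeasurable" using \<open>open S\<close> \<open>bounded S\<close> by (simp add: lmeasurable_open)
  have Sb: "S \<in> sets borel" using \<open>open S\<close> by simp
  have "measure lebesgue (box l u) = \<bar>det C\<bar> * measure lebesgue S"
    using measure_linear_image[OF matrix_vector_mul_linear S, of C] by (simp add: CS)
  moreover have "measure lebesgue (box l u) = (\<Prod>b\<in>Basis. (u - l) \<bullet> b)"
    using lu by simp
  moreover have "emeasure lborel S = ennreal (measure lebesgue S)"
    using emeasure_eq_measure2[OF S] Sb by simp
  ultimately have "ennreal \<bar>det C\<bar> * emeasure lborel S = (\<Prod>b\<in>Basis. (u - l) \<bullet> b)"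
    by (simp only: ennreal_mult'[symmetric] abs_ge_zero)
  moreover have "emeasure (density (distr lborel borel ((*v) C)) (\<lambda>_. ennreal \<bar>det C\<bar>)) (box l u)
      = ennreal \<bar>det C\<bar> * emeasure (distr lborel borel ((*v) C)) (box l u)"
    by (rule emeasure_density_const) simp
  moreover have "emeasure (distr lborel borel ((*v) C)) (box l u) = emeasure lborel S"
    by (subst emeasure_distr) (simp_all add: S_def)
  ultimately show "emeasure (density (distr lborel borel ((*v) C)) (\<lambda>_. ennreal \<bar>det C\<bar>)) (box l u)
      = (\<Prod>b\<in>Basis. (u - l) \<bullet> b)"
    by simp
qed simp

lemma nn_integral_lborel_affine:
  fixes C :: "real^'m::{finite,wellorder}^'m::_"
  assumes "det C \<noteq> 0" and [measurable]: "h \<in> borel_measurable borel"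
  shows "(\<integral>\<^sup>+x. h x \<partial>lborel) = ennreal \<bar>det C\<bar> * (\<integral>\<^sup>+x. h (a + C *v x) \<partial>lborel)"
proof -
  have [measurable]: "(*v) C \<in> borel \<rightarrow>\<^sub>M borel"
    by (intro borel_measurable_continuous_onI linear_continuous_on matrix_vector_mul_bounded_linear)
  have "(\<integral>\<^sup>+x. h x \<partial>lborel) = (\<integral>\<^sup>+x. h x \<partial>(distr lborel borel ((+) a)))"
    by (simp only: lborel_distr_plus)
  also have "\<dots> = (\<integral>\<^sup>+x. h (a + x) \<partial>lborel)"
    by (subst nn_integral_distr) simp_all
  also have "\<dots> = (\<integral>\<^sup>+x. h (a + x) \<partial>(density (distr lborel borel ((*v) C)) (\<lambda>_. ennreal \<bar>det C\<bar>)))"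
    by (simp only: lborel_linear[OF assms(1), symmetric])
  also have "\<dots> = (\<integral>\<^sup>+x. ennreal \<bar>det C\<bar> * h (a + x) \<partial>(distr lborel borel ((*v) C)))"
    by (rule nn_integral_density) measurable
  also have "\<dots> = (\<integral>\<^sup>+x. ennreal \<bar>det C\<bar> * h (a + C *v x) \<partial>lborel)"
    by (rule nn_integral_distr) measurable
  also have "\<dots> = ennreal \<bar>det C\<bar> * (\<integral>\<^sup>+x. h (a + C *v x) \<partial>lborel)"
    by (rule nn_integral_cmult) measurable
  finally show ?thesis .
qed


text \<open>The Jacobian matrix \<open>C\<close> has the columns \<open>B\<close> and
  \<open>b\<close>. It differs from the orthogonal matrix \<open>A\<close> with columns
  \<open>B\<close> and \<open>n\<close> in one column, so Cramer's rule gives its determinant up to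
  sign as b . n. Tonelli then separates the axis variable.\<close>

lemma nn_integral_lborel_onb_axis_wellorder:
  fixes n b a :: "real^'m::{finite,wellorder}" and B :: "(real^'m::_) set" and h :: "real^'m::_ \<Rightarrow> ennreal"
  assumes n: "norm n = 1" and orth: "pairwise orthogonal B" and norm: "\<And>e. e \<in> B \<Longrightarrow> norm e = 1"
    and span: "span B = {x. n \<bullet> x = 0}" and bn: "b \<bullet> n \<noteq> 0"
    and h[measurable]: "h \<in> borel_measurable borel"
  shows "(\<integral>\<^sup>+x. h x \<partial>lborel) = ennreal \<bar>b \<bullet> n\<bar> *
    (\<integral>\<^sup>+y. (\<integral>\<^sup>+t. h (a + (\<Sum>e\<in>B. y e *\<^sub>R e) + t *\<^sub>R b) \<partial>lborel) \<partial>(\<Pi>\<^sub>M e\<in>B. (lborel :: real measure)))"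
proof -
  have nB: "n \<bullet> e = 0" if "e \<in> B" for e using span span_base[OF that] by blast
  have "independent B"
    using norm[of 0] by (intro pairwise_orthogonal_independent[OF orth]) auto
  then have finB: "finite B" and "card B = dim {x. n \<bullet> x = 0}"
    using dim_span_eq_card_independent[OF \<open>independent B\<close>] span by (auto simp: independent_imp_finite)
  moreover have "n \<noteq> 0" using n by auto
  ultimately have "card B = CARD('m) - 1" by (simp add: dim_hyperplane)
  moreover have "n \<notin> B" using nB[of n] \<open>n \<noteq> 0\<close> by auto
  ultimately have "card (UNIV :: 'm::_ set) = card (insert n B)"
    using finB by simp
  \<comment> \<open>Numbers the columns: \<open>B\<close> has d - 1 elements and \<open>n\<close> is
    the remaining one, placed at index \<open>i0\<close>.\<close>
  then obtain q where q: "bij_betw q (UNIV :: 'm::_ set) (insert n B)"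
    using finite_same_card_bij[of "UNIV :: 'm::_ set" "insert n B"] finB by auto
  then have inj_q: "inj q" and range_q: "range q = insert n B" by (auto simp: bij_betw_def)
  then obtain i0 where i0: "q i0 = n" by (metis insertI1 rangeE)
  have qB: "q j \<in> B" if "j \<noteq> i0" for j
  proof -
    have "q j \<noteq> q i0" using inj_q that by (simp add: inj_eq)
    moreover have "q j \<in> insert n B" unfolding range_q[symmetric] by simp
    ultimately show ?thesis using i0 by simp
  qed
  define A :: "real^'m::_^'m::_" where "A = (\<chi> i j. q j $ i)"
  have col: "column j A = q j" for j by (simp add: column_def A_def vec_eq_iff)
  have nq: "norm (q j) = 1" for j using norm n qB i0 by (cases "j = i0") auto
  have "orthogonal_matrix A"
    unfolding orthogonal_matrix_orthonormal_columns col
  proof (intro conjI allI impI nq)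
    fix i j :: "'m::_" assume "i \<noteq> j"
    then have ne: "q i \<noteq> q j" using inj_q by (simp add: inj_eq)
    show "orthogonal (q i) (q j)"
    proof (cases "i = i0 \<or> j = i0")
      case True
      then show ?thesis
      proof
        assume "i = i0"
        then show ?thesis using nB[OF qB[of j]] \<open>i \<noteq> j\<close> i0 by (simp add: orthogonal_def)
      next
        assume "j = i0"
        then show ?thesis using nB[OF qB[of i]] \<open>i \<noteq> j\<close> i0 by (simp add: orthogonal_def inner_commute)
      qed
    next
      case False
      then show ?thesis using orth qB ne unfolding pairwise_def by blast
    qed
  qed
  then have detA: "\<bar>det A\<bar> = 1" and AA: "A ** transpose A = mat 1"
    using det_orthogonal_matrix[of A] by (auto simp: orthogonal_matrix_def)
  \<comment> \<open>The solution of A x = b, since \<open>A\<close> is orthogonal; its entry at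
    \<open>i0\<close> is the inner product of \<open>b\<close> with the column
    \<open>n\<close>.\<close>
  define x where "x = transpose A *v b"
  have Ax: "A *v x = b" unfolding x_def matrix_vector_mul_assoc AA by simp
  have x0: "x $ i0 = b \<bullet> n"
    by (simp add: x_def matrix_vector_mult_def transpose_def A_def i0 inner_vec_def mult.commute)
  define C :: "real^'m::_^'m::_" where "C = (\<chi> i j. if j = i0 then b $ i else A $ i $ j)"
  have "det C = (b \<bullet> n) * det A"
    using cramer_lemma[of i0 A x] unfolding Ax x0 C_def[symmetric] .
  then have detC: "\<bar>det C\<bar> = \<bar>b \<bullet> n\<bar>" by (simp add: abs_mult detA)
  then have C0: "det C \<noteq> 0" using bn by auto
  have C_axis: "C *v axis j 1 = (if j = i0 then b else q j)" for j
    by (simp add: matrix_vector_mult_basis column_def C_def A_def vec_eq_iff)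
  have [measurable]: "(*v) C \<in> borel \<rightarrow>\<^sub>M borel"
    by (intro borel_measurable_continuous_onI linear_continuous_on matrix_vector_mul_bounded_linear)

  \<comment> \<open>The basis vector that \<open>C\<close> sends to \<open>b\<close>; its coordinate
    becomes \<open>t\<close>. The remaining basis vectors \<open>J\<close> are mapped bijectively
    onto \<open>B\<close>.\<close>
  define u :: "real^'m::_" where "u = axis i0 1"
  define J :: "(real^'m::_) set" where "J = Basis - {u}"
  have uB: "u \<in> Basis" by (simp add: u_def)
  have J: "finite J" "u \<notin> J" "insert u J = Basis" using uB by (auto simp: J_def)
  have J_eq: "J = (\<lambda>j. axis j 1) ` (UNIV - {i0})"
    by (auto simp: J_def u_def Basis_vec_def axis_eq_axis)
  have inj_C: "inj ((*v) C)"
    using C0 invertible_det_nz by (auto simp: invertible_left_inverse matrix_left_invertible_injective)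
  have Q: "bij_betw ((*v) C) J B"
    unfolding bij_betw_def
  proof
    have "(*v) C ` J = q ` (UNIV - {i0})"
      unfolding J_eq image_image by (intro image_cong) (auto simp: C_axis)
    also have "\<dots> = insert n B - {n}"
      using inj_q range_q i0 by (simp add: image_set_diff)
    finally show "(*v) C ` J = B" using \<open>n \<notin> B\<close> by simp
    show "inj_on ((*v) C) J"
      using inj_on_subset[OF inj_C] by blast
  qed
  interpret product_sigma_finite "\<lambda>_::real^'m::_. lborel :: real measure" by unfold_locales
  let ?L = "lborel :: real measure"
  have "(\<integral>\<^sup>+x. h x \<partial>lborel) = ennreal \<bar>b \<bullet> n\<bar> * (\<integral>\<^sup>+x. h (a + C *v x) \<partial>lborel)"
    using nn_integral_lborel_affine[OF C0 h] detC by simp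
  also have "(\<integral>\<^sup>+x. h (a + C *v x) \<partial>lborel) =
      (\<integral>\<^sup>+f. h (a + C *v (\<Sum>e\<in>Basis. f e *\<^sub>R e)) \<partial>(\<Pi>\<^sub>M e\<in>Basis. ?L))"
    by (subst lborel_eq) (simp add: nn_integral_distr)
  also have "\<dots> = (\<integral>\<^sup>+f. h (a + C *v (\<Sum>e\<in>insert u J. f e *\<^sub>R e)) \<partial>(\<Pi>\<^sub>M e\<in>insert u J. ?L))"
    by (simp only: J(3))
  also have "\<dots> = (\<integral>\<^sup>+f. (\<integral>\<^sup>+t. h (a + C *v (\<Sum>e\<in>insert u J. (f(u := t)) e *\<^sub>R e)) \<partial>lborel) \<partial>(\<Pi>\<^sub>M e\<in>J. ?L))"
    by (rule product_nn_integral_insert[OF J(1,2)]) measurable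
  also have "\<dots> = (\<integral>\<^sup>+f. (\<integral>\<^sup>+t. h (a + (\<Sum>e\<in>B. (\<lambda>e\<in>B. f (the_inv_into J ((*v) C) e)) e *\<^sub>R e) + t *\<^sub>R b) \<partial>lborel)
      \<partial>(\<Pi>\<^sub>M e\<in>J. ?L))"
  proof (intro nn_integral_cong arg_cong[of _ _ h])
    fix f t
    have "(\<Sum>e\<in>insert u J. (f(u := t)) e *\<^sub>R e) = t *\<^sub>R u + (\<Sum>e\<in>J. f e *\<^sub>R e)"
      using J(1,2) by (auto intro!: sum.cong)
    then have "C *v (\<Sum>e\<in>insert u J. (f(u := t)) e *\<^sub>R e) = t *\<^sub>R (C *v u) + (\<Sum>e\<in>J. f e *\<^sub>R (C *v e))"
      by (simp add: linear_add[OF matrix_vector_mul_linear] linear_sum[OF matrix_vector_mul_linear]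
          linear_scale[OF matrix_vector_mul_linear])
    also have "C *v u = b" by (simp add: u_def C_axis)
    also have "(\<Sum>e\<in>J. f e *\<^sub>R (C *v e)) =
        (\<Sum>e\<in>J. f (the_inv_into J ((*v) C) (C *v e)) *\<^sub>R (C *v e))"
      using Q by (intro sum.cong refl) (simp add: bij_betw_def the_inv_into_f_f)
    also have "\<dots> = (\<Sum>e\<in>B. f (the_inv_into J ((*v) C) e) *\<^sub>R e)"
      by (rule sum.reindex_bij_betw[OF Q])
    also have "\<dots> = (\<Sum>e\<in>B. (\<lambda>e\<in>B. f (the_inv_into J ((*v) C) e)) e *\<^sub>R e)"
      by (intro sum.cong) auto
    finally show "a + C *v (\<Sum>e\<in>insert u J. (f(u := t)) e *\<^sub>R e) =
        a + (\<Sum>e\<in>B. (\<lambda>e\<in>B. f (the_inv_into J ((*v) C) e)) e *\<^sub>R e) + t *\<^sub>R b"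
      by (simp only: add_ac)
  qed
  also have "\<dots> = (\<integral>\<^sup>+y. (\<integral>\<^sup>+t. h (a + (\<Sum>e\<in>B. y e *\<^sub>R e) + t *\<^sub>R b) \<partial>lborel) \<partial>(\<Pi>\<^sub>M e\<in>B. ?L))"
    by (rule nn_integral_PiM_reindex[OF J(1) Q, symmetric]) measurable
  finally show ?thesis .
qed

text \<open>
  The determinant formula for the measure of linear images (\<open>measure_linear_image\<close>) is only
  available for well-ordered index types; every finite index type has a well-ordered copy.
\<close>

typedef 'n wellordered = "UNIV :: 'n set" by simp

instance wellordered :: (finite) finite
proof
  have "(UNIV :: 'a wellordered set) = range Abs_wellordered"
    by (metis Rep_wellordered_inverse surj_def)
  then show "finite (UNIV :: 'a wellordered set)" by (metis finite finite_imageI)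
qed

instantiation wellordered :: (finite) wellorder
begin

text \<open>Any injection serves: the order of the naturals is pulled back along it, and injectivity
  gives antisymmetry.\<close>

definition wellordered_rank :: "'a wellordered \<Rightarrow> nat"
  where "wellordered_rank = (SOME f. inj f)"

definition "x \<le> y \<longleftrightarrow> wellordered_rank x \<le> wellordered_rank (y :: 'a wellordered)"
definition "x < y \<longleftrightarrow> wellordered_rank x < wellordered_rank (y :: 'a wellordered)"

lemma inj_wellordered_rank: "inj (wellordered_rank :: 'a wellordered \<Rightarrow> nat)"
proof -
  have "\<exists>f :: 'a wellordered \<Rightarrow> nat. inj f"
    using finite_imp_inj_to_nat_seg[of "UNIV :: 'a wellordered set"] by auto
  then show ?thesis unfolding wellordered_rank_def by (rule someI_ex)
qed

instance
proof
  fix P :: "'a wellordered \<Rightarrow> bool" and a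
  assume step: "\<And>x. (\<And>y. y < x \<Longrightarrow> P y) \<Longrightarrow> P x"
  show "P a"
  proof (induction a rule: measure_induct_rule[of wellordered_rank])
    case (less x)
    show ?case by (rule step) (rule less.IH, simp only: less_wellordered_def)
  qed
next
  fix x y z :: "'a wellordered"
  show "x \<le> y \<Longrightarrow> y \<le> x \<Longrightarrow> x = y"
    unfolding less_eq_wellordered_def by (rule injD[OF inj_wellordered_rank]) (rule antisym)
qed (auto simp: less_eq_wellordered_def less_wellordered_def)

end

text \<open>Renaming coordinates turns boxes into boxes with the same side lengths.\<close>

lemma lborel_vec_reindex:
  fixes \<rho> :: "'n::finite \<Rightarrow> 'm::finite"
  assumes \<rho>: "bij \<rho>"
  shows "(lborel :: (real^'n) measure) = distr lborel borel (\<lambda>x::real^'m. \<chi> i. x $ \<rho> i)"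
proof (rule lborel_eqI)
  let ?\<psi> = "\<lambda>x::real^'m. \<chi> i. x $ \<rho> i"
  have "continuous_on UNIV ?\<psi>" by (intro continuous_intros)
  then have [measurable]: "?\<psi> \<in> borel \<rightarrow>\<^sub>M borel" by (rule borel_measurable_continuous_onI)
  have inv: "\<rho> (inv \<rho> j) = j" "inv \<rho> (\<rho> i) = i" for i j
    using \<rho> by (simp_all add: bij_def surj_f_inv_f)
  fix l u :: "real^'n" assume lu: "\<And>b. b \<in> Basis \<Longrightarrow> l \<bullet> b \<le> u \<bullet> b"
  define l' u' :: "real^'m::_" where "l' = (\<chi> j. l $ inv \<rho> j)" and "u' = (\<chi> j. u $ inv \<rho> j)"
  have "?\<psi> -` box l u = box l' u'"
    unfolding l'_def u'_def by (auto simp: mem_box_cart) (metis inv)+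
  moreover have "l' \<bullet> b \<le> u' \<bullet> b" if b: "b \<in> Basis" for b
  proof -
    obtain j where "b = axis j 1" using b by (auto simp: Basis_vec_def)
    moreover have "axis (inv \<rho> j) 1 \<in> (Basis :: (real^'n) set)" by simp
    ultimately show ?thesis using lu[of "axis (inv \<rho> j) 1"] by (simp add: l'_def u'_def inner_axis)
  qed
  ultimately have "emeasure (distr lborel borel ?\<psi>) (box l u) = (\<Prod>b\<in>Basis. (u' - l') \<bullet> b)"
    by (simp add: emeasure_distr)
  also have "(\<Prod>b\<in>Basis. (u' - l') \<bullet> b) = (\<Prod>j\<in>UNIV. (u - l) $ inv \<rho> j)"
    by (simp add: Basis_vec_def prod.UNION_disjoint axis_eq_axis inner_axis l'_def u'_def
        prod.reindex inj_on_def UNION_singleton_eq_range)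
  also have "\<dots> = (\<Prod>i\<in>UNIV. (u - l) $ i)"
    by (rule prod.reindex_bij_betw) (use \<rho> in \<open>simp add: bij_imp_bij_inv\<close>)
  also have "\<dots> = (\<Prod>b\<in>Basis. (u - l) \<bullet> b)"
    by (simp add: Basis_vec_def axis_eq_axis inner_axis prod.reindex inj_on_def UNION_singleton_eq_range)
  finally show "emeasure (distr lborel borel ?\<psi>) (box l u) = (\<Prod>b\<in>Basis. (u - l) \<bullet> b)" .
qed simp

text \<open>Renaming coordinates is a linear isometry that preserves \<open>lborel\<close>, so all
  data are moved to the well-ordered copy and the product over the image of \<open>B\<close> is
  relabelled back to \<open>B\<close>.\<close>

lemma nn_integral_lborel_onb_axis:
  fixes n b a :: "real^'n" and B :: "(real^'n) set" and h :: "real^'n \<Rightarrow> ennreal"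
  assumes n: "norm n = 1" and orth: "pairwise orthogonal B" and norm: "\<And>e. e \<in> B \<Longrightarrow> norm e = 1"
    and span: "span B = {x. n \<bullet> x = 0}" and bn: "b \<bullet> n \<noteq> 0"
    and h[measurable]: "h \<in> borel_measurable borel"
  shows "(\<integral>\<^sup>+x. h x \<partial>lborel) = ennreal \<bar>b \<bullet> n\<bar> *
    (\<integral>\<^sup>+y. (\<integral>\<^sup>+t. h (a + (\<Sum>e\<in>B. y e *\<^sub>R e) + t *\<^sub>R b) \<partial>lborel) \<partial>(\<Pi>\<^sub>M e\<in>B. (lborel :: real measure)))"
proof -
  define \<psi> :: "real^'n wellordered \<Rightarrow> real^'n" where "\<psi> x = (\<chi> i. x $ Abs_wellordered i)" for x
  define \<psi>' :: "real^'n \<Rightarrow> real^'n wellordered" where "\<psi>' x = (\<chi> j. x $ Rep_wellordered j)" for x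
  have bij: "bij (Abs_wellordered :: 'n \<Rightarrow> 'n wellordered)" "bij (Rep_wellordered :: 'n wellordered \<Rightarrow> 'n)"
    by (rule bij_betw_byWitness[of _ Rep_wellordered] bij_betw_byWitness[of _ Abs_wellordered];
        simp add: Rep_wellordered_inverse Abs_wellordered_inverse)+
  have inv: "\<psi> (\<psi>' x) = x" "\<psi>' (\<psi> y) = y" for x y
    by (simp_all add: \<psi>_def \<psi>'_def vec_eq_iff Rep_wellordered_inverse Abs_wellordered_inverse)
  have lin: "linear \<psi>" "linear \<psi>'"
    by (auto intro!: linearI simp: \<psi>_def \<psi>'_def vec_eq_iff)
  have inner: "\<psi>' x \<bullet> \<psi>' y = x \<bullet> y" for x y
    using sum.reindex_bij_betw[OF bij(2), of "\<lambda>i. x $ i * y $ i"] by (simp add: inner_vec_def \<psi>'_def)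
  then have norm_eq: "norm (\<psi>' x) = norm x" for x by (simp add: norm_eq_sqrt_inner)
  have [measurable]: "\<psi> \<in> borel \<rightarrow>\<^sub>M borel"
    by (intro borel_measurable_continuous_onI linear_continuous_on) (simp add: lin linear_conv_bounded_linear[symmetric])
  have "inj \<psi>'" using inv(1) by (metis injI)
  then have Q: "bij_betw \<psi>' B (\<psi>' ` B)" by (meson bij_betw_imageI inj_on_subset subset_UNIV)
  have "independent B" using norm[of 0] by (intro pairwise_orthogonal_independent[OF orth]) auto
  then have finB: "finite B" by (rule independent_imp_finite)
  have span': "span (\<psi>' ` B) = {x. \<psi>' n \<bullet> x = 0}"
  proof -
    have "span (\<psi>' ` B) = \<psi>' ` {x. n \<bullet> x = 0}" using lin(2) span by (simp add: span_linear_image)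
    also have "\<dots> = {x. \<psi>' n \<bullet> x = 0}"
    proof (intro set_eqI iffI)
      fix x assume "x \<in> {x. \<psi>' n \<bullet> x = 0}"
      then have "n \<bullet> \<psi> x = 0" using inner[of n "\<psi> x"] by (simp add: inv)
      then have "\<psi>' (\<psi> x) \<in> \<psi>' ` {x. n \<bullet> x = 0}" by blast
      then show "x \<in> \<psi>' ` {x. n \<bullet> x = 0}" by (simp add: inv)
    qed (auto simp: inner)
    finally show ?thesis .
  qed
  let ?L = "lborel :: real measure"
  have "(\<integral>\<^sup>+x. h x \<partial>lborel) = (\<integral>\<^sup>+x. h (\<psi> x) \<partial>lborel)"
    unfolding \<psi>_def by (subst lborel_vec_reindex[OF bij(1)]) (subst nn_integral_distr; simp add: \<psi>_def[abs_def, symmetric])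
  also have "\<dots> = ennreal \<bar>\<psi>' b \<bullet> \<psi>' n\<bar> * (\<integral>\<^sup>+y. (\<integral>\<^sup>+t. h (\<psi> (\<psi>' a + (\<Sum>e\<in>\<psi>' ` B. y e *\<^sub>R e) + t *\<^sub>R \<psi>' b)) \<partial>lborel)
      \<partial>(\<Pi>\<^sub>M e\<in>\<psi>' ` B. ?L))"
  proof (rule nn_integral_lborel_onb_axis_wellorder)
    show "pairwise orthogonal (\<psi>' ` B)"
      using orth by (auto simp: pairwise_def orthogonal_def inner)
  qed (use n norm span' bn in \<open>auto simp: inner norm_eq\<close>)
  also have "(\<integral>\<^sup>+y. (\<integral>\<^sup>+t. h (\<psi> (\<psi>' a + (\<Sum>e\<in>\<psi>' ` B. y e *\<^sub>R e) + t *\<^sub>R \<psi>' b)) \<partial>lborel) \<partial>(\<Pi>\<^sub>M e\<in>\<psi>' ` B. ?L)) =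
      (\<integral>\<^sup>+x. (\<integral>\<^sup>+t. h (\<psi> (\<psi>' a + (\<Sum>e\<in>\<psi>' ` B. (\<lambda>e\<in>\<psi>' ` B. x (the_inv_into B \<psi>' e)) e *\<^sub>R e) + t *\<^sub>R \<psi>' b)) \<partial>lborel)
      \<partial>(\<Pi>\<^sub>M e\<in>B. ?L))"
    by (rule nn_integral_PiM_reindex[OF finB Q]) measurable
  also have "\<dots> = (\<integral>\<^sup>+x. (\<integral>\<^sup>+t. h (a + (\<Sum>e\<in>B. x e *\<^sub>R e) + t *\<^sub>R b) \<partial>lborel) \<partial>(\<Pi>\<^sub>M e\<in>B. ?L))"
  proof (intro nn_integral_cong arg_cong[of _ _ h])
    fix x t
    have "(\<Sum>e\<in>\<psi>' ` B. (\<lambda>e\<in>\<psi>' ` B. x (the_inv_into B \<psi>' e)) e *\<^sub>R e) =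
        (\<Sum>e\<in>B. (\<lambda>e\<in>\<psi>' ` B. x (the_inv_into B \<psi>' e)) (\<psi>' e) *\<^sub>R \<psi>' e)"
      by (rule sum.reindex_bij_betw[OF Q, symmetric])
    also have "\<dots> = (\<Sum>e\<in>B. x e *\<^sub>R \<psi>' e)"
      using Q by (intro sum.cong refl) (simp add: bij_betw_def the_inv_into_f_f)
    finally show "\<psi> (\<psi>' a + (\<Sum>e\<in>\<psi>' ` B. (\<lambda>e\<in>\<psi>' ` B. x (the_inv_into B \<psi>' e)) e *\<^sub>R e) + t *\<^sub>R \<psi>' b) =
        a + (\<Sum>e\<in>B. x e *\<^sub>R e) + t *\<^sub>R b"
      by (simp add: linear_add[OF lin(1)] linear_scale[OF lin(1)] linear_sum[OF lin(1)] inv)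
  qed
  finally show ?thesis by (simp add: inner)
qed

subsection \<open>Traces on a face\<close>

lemma norm_le_max_norm:
  fixes T :: "(real^'n) set"
  assumes "bounded T" "x \<in> T"
  shows "norm x \<le> max_norm T"
  unfolding max_norm_def
proof (rule cSUP_upper)
  show "x \<in> closure T" using assms closure_subset by blast
  show "bdd_above (norm ` closure T)"
    using bounded_closure[OF assms(1)] by (intro bounded_imp_bdd_above) (simp add: bounded_norm_comp)
qed

context element_facet begin

text \<open>Every subspace has an orthonormal basis, so the choice in \<open>direction_onb\<close>
  returns one.\<close>

lemma direction_onb:
  assumes n: "outward_normal T F n"
  shows "pairwise orthogonal (direction_onb F)" "\<And>e. e \<in> direction_onb F \<Longrightarrow> norm e = 1"
    "span (direction_onb F) = {x. n \<bullet> x = 0}"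
proof -
  have "subspace (direction_space F)" by (simp add: direction_space_def)
  then have "\<exists>B. pairwise orthogonal B \<and> (\<forall>e\<in>B. norm e = 1) \<and> span B = direction_space F"
    by (metis orthonormal_basis_subspace)
  then have "pairwise orthogonal (direction_onb F) \<and> (\<forall>e\<in>direction_onb F. norm e = 1) \<and>
      span (direction_onb F) = direction_space F"
    unfolding direction_onb_def by (rule someI_ex)
  then show "pairwise orthogonal (direction_onb F)" "\<And>e. e \<in> direction_onb F \<Longrightarrow> norm e = 1"
    "span (direction_onb F) = {x. n \<bullet> x = 0}"
    using direction_space_hyperplane[OF n] by auto
qed

text \<open>Tonelli in oblique coordinates: the surface measure is the image of the same product
  measure, with the chosen point of \<open>F\<close> as origin, and
  \<open>\<bar>b \<bullet> n\<bar>\<close> is the Jacobian.\<close>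

lemma nn_integral_surface_axis:
  assumes n: "outward_normal T F n" and bn: "b \<bullet> n \<noteq> 0"
    and [measurable]: "h \<in> borel_measurable borel"
  shows "(\<integral>\<^sup>+x. h x \<partial>lborel) =
    ennreal \<bar>b \<bullet> n\<bar> * (\<integral>\<^sup>+s. (\<integral>\<^sup>+t. h (s + t *\<^sub>R b) \<partial>lborel) \<partial>surface_measure F)"
proof -
  have nn: "norm n = 1" using n by (simp add: outward_normal_def)
  show ?thesis
    unfolding surface_measure_def
    by (subst nn_integral_distr; (measurable)?)
      (rule nn_integral_lborel_onb_axis[OF nn direction_onb[OF n] bn assms(3)])
qed

lemma prism_trace:
  fixes P :: "real^'n \<Rightarrow> real" and k m p :: nat
  assumes P: "\<And>x. P x = (\<Sum>\<alpha> | (\<Sum>i\<in>UNIV. \<alpha> i) \<le> p. c \<alpha> * (\<Prod>i\<in>UNIV. (x $ i) ^ \<alpha> i))"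
    and k: "1 \<le> k" and m: "max_norm T ^ (2 * k) \<le> 2 * real m"
    and n: "outward_normal T F n" and bn: "b \<bullet> n \<noteq> 0"
    and prism: "\<And>s t. s \<in> H \<Longrightarrow> t \<in> {0..1} \<Longrightarrow> s + t *\<^sub>R b \<in> T"
    and g: "g = (\<lambda>x. ennreal ((P x)\<^sup>2 * weight k x))" and gm[measurable]: "g \<in> borel_measurable borel"
  shows "ennreal \<bar>b \<bullet> n\<bar> * (\<integral>\<^sup>+s\<in>H. g s \<partial>surface_measure F) \<le>
    ennreal ((real (p + m + 1))\<^sup>2) * (\<integral>\<^sup>+x\<in>T. g x \<partial>lborel)"
proof -
  have [measurable]: "T \<in> sets borel" using closed by simp
  let ?h = "\<lambda>x. g x * indicator T x" and ?D = "ennreal ((real (p + m + 1))\<^sup>2)"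
  have [measurable_cong]: "sets (surface_measure F) = sets borel"
    by (simp add: surface_measure_def)
  \<comment> \<open>The pointwise bound is extended by a nonnegative right-hand side to the whole
    hyperplane, and \<open>T\<close> is encoded by its indicator, so that Tonelli applies on the
    full space.\<close>
  have "(\<integral>\<^sup>+s\<in>H. g s \<partial>surface_measure F) \<le>
      (\<integral>\<^sup>+s. ?D * (\<integral>\<^sup>+t. ?h (s + t *\<^sub>R b) \<partial>lborel) \<partial>surface_measure F)"
  proof (rule nn_integral_mono)
    fix s
    show "g s * indicator H s \<le> ?D * (\<integral>\<^sup>+t. ?h (s + t *\<^sub>R b) \<partial>lborel)"
    proof (cases "s \<in> H")
      case True
      then have "s + b \<in> T" using prism[of s 1] by simp
      then have "norm (s + b) \<le> max_norm T" by (rule norm_le_max_norm[OF bounded])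
      from weighted_trace_on_line[OF P k this m]
      have "g s \<le> ?D * (\<integral>\<^sup>+t\<in>{0..1}. g (s + t *\<^sub>R b) \<partial>lborel)" unfolding g .
      also have "\<dots> \<le> ?D * (\<integral>\<^sup>+t. ?h (s + t *\<^sub>R b) \<partial>lborel)"
        using prism[OF True] by (intro mult_left_mono nn_integral_mono) (auto simp: indicator_def)
      finally show ?thesis using True by simp
    qed simp
  qed
  also have "\<dots> = ?D * (\<integral>\<^sup>+s. (\<integral>\<^sup>+t. ?h (s + t *\<^sub>R b) \<partial>lborel) \<partial>surface_measure F)"
    by (rule nn_integral_cmult) measurable
  finally have "ennreal \<bar>b \<bullet> n\<bar> * (\<integral>\<^sup>+s\<in>H. g s \<partial>surface_measure F) \<le>
      ?D * (ennreal \<bar>b \<bullet> n\<bar> * (\<integral>\<^sup>+s. (\<integral>\<^sup>+t. ?h (s + t *\<^sub>R b) \<partial>lborel) \<partial>surface_measure F))"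
    by (simp add: mult_left_mono mult.left_commute)
  also have "ennreal \<bar>b \<bullet> n\<bar> * (\<integral>\<^sup>+s. (\<integral>\<^sup>+t. ?h (s + t *\<^sub>R b) \<partial>lborel) \<partial>surface_measure F) =
      (\<integral>\<^sup>+x. ?h x \<partial>lborel)"
    by (rule nn_integral_surface_axis[OF n bn, symmetric]) measurable
  finally show ?thesis .
qed

end

text \<open>As \<open>x\<close> may be infinite, the division is a multiplication by the finite
  number 1 / \<rho>.\<close>

lemma ennreal_le_mult_divide:
  fixes x y :: ennreal and \<rho> a D :: real
  assumes "ennreal a * x \<le> ennreal D * y" "0 < \<rho>" "\<rho> \<le> a" "0 \<le> D"
  shows "x \<le> ennreal (D / \<rho>) * y"
proof -
  have "ennreal \<rho> * x \<le> ennreal D * y"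
    using assms(1) mult_right_mono[OF ennreal_leI[OF assms(3)], of x] by simp
  then have "ennreal (1 / \<rho>) * (ennreal \<rho> * x) \<le> ennreal (1 / \<rho>) * (ennreal D * y)"
    by (rule mult_left_mono) simp
  then show ?thesis
    using assms by (simp add: mult.assoc[symmetric] ennreal_mult[symmetric])
qed

section \<open>Summation over the subfaces and the constant\<close>

theorem lemma5p8:
  fixes T F :: "(real^'n) set"
    and p k M :: nat
    and G :: "nat \<Rightarrow> (real^'n) set"
    and b :: "nat \<Rightarrow> real^'n"
    and v :: "real^'n \<Rightarrow> real"
  assumes "1 \<le> p" and "1 \<le> k"
    and "simplicial_element T \<and> simplex_prisms T F M G b \<or>
         box_element T \<and> box_prism T F M G b"
    and "F facet_of T"
    and "poly_on p T v"
  shows "(LINT s:F|surface_measure F. (v s)\<^sup>2 * weight k s)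
         \<le> c_inv T F M b p k (max_norm T) * ((real p)\<^sup>2 / diameter T) *
            (LINT x:T|lborel. (v x)\<^sup>2 * weight k x)"
proof -
  interpret element_facet T F
    using assms(3,4) simplicial_element_polytope box_element_polytope by unfold_locales auto
  have "closed F"
    using face_of_polytope_polytope[OF polytope facet_of_imp_face_of[OF assms(4)]] polytope_imp_closed
    by blast
  have G: "F \<subseteq> (\<Union>i<M. G i)" "\<And>i. i < M \<Longrightarrow> closed (G i)"
    "\<And>i. i < M \<Longrightarrow> oblique_prism (G i) (b i) \<subseteq> T"
    "\<And>i n. i < M \<Longrightarrow> outward_normal T F n \<Longrightarrow> inradius T \<le> \<bar>b i \<bullet> n\<bar>"
  proof -
    consider "simplex_prisms T F M G b" | "box_prism T F M G b" using assms(3) by blast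
    then have "F \<subseteq> (\<Union>i<M. G i) \<and> (\<forall>i<M. closed (G i) \<and> oblique_prism (G i) (b i) \<subseteq> T \<and>
        (\<forall>n. outward_normal T F n \<longrightarrow> inradius T \<le> \<bar>b i \<bullet> n\<bar>))"
    proof cases
      case 1
      then have "F \<subseteq> (\<Union>i<M. G i)" "\<forall>i<M. polytope (G i) \<and> oblique_prism (G i) (b i) \<subseteq> T"
        unfolding simplex_prisms_def by blast+
      then show ?thesis using simplex_prisms_axis[OF 1] polytope_imp_closed by blast
    next
      case 2
      then have "M = 1" "G 0 = F" "T = closure (oblique_prism F (b 0))"
        unfolding box_prism_def by auto
      then show ?thesis
        using box_prism_axis[OF 2] \<open>closed F\<close> closure_subset[of "oblique_prism F (b 0)"] by auto
    qed
    then show "F \<subseteq> (\<Union>i<M. G i)" "\<And>i. i < M \<Longrightarrow> closed (G i)"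
      "\<And>i. i < M \<Longrightarrow> oblique_prism (G i) (b i) \<subseteq> T"
      "\<And>i n. i < M \<Longrightarrow> outward_normal T F n \<Longrightarrow> inradius T \<le> \<bar>b i \<bullet> n\<bar>"
      by blast+
  qed
  then have "0 < M" using face_nonempty by (cases M) auto
  have \<rho>: "0 < inradius T" by (rule inradius_pos[OF bounded interior_nonempty])
  obtain n where n: "outward_normal T F n" using outward_normal_exists by blast
  have bn: "b i \<bullet> n' \<noteq> 0" if "i < M" "outward_normal T F n'" for i n'
    using G(4)[OF that] \<rho> by auto
  define s where "s = Min (sin ` element_angles T F M b)"
  have s: "0 < s" "s \<le> 1"
    using Min_sin_angles[OF \<open>0 < M\<close> bn] by (simp_all add: s_def)

  define \<delta> where "\<delta> = max_norm T"
  obtain x0 where "x0 \<in> T" using face_nonempty face_subset by blast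
  then have \<delta>0: "0 \<le> \<delta>" unfolding \<delta>_def using norm_le_max_norm[OF bounded] norm_ge_zero order_trans by blast
  \<comment> \<open>The least natural number with 2m \<ge> \<open>\<delta> ^ (2 * k)\<close>;
    rounding up costs at most 2.\<close>
  define m where "m = nat \<lceil>\<delta> ^ (2 * k) / 2\<rceil>"
  have m: "\<delta> ^ (2 * k) \<le> 2 * real m" "2 * real m \<le> \<delta> ^ (2 * k) + 2"
  proof -
    have "real m = of_int \<lceil>\<delta> ^ (2 * k) / 2\<rceil>" using \<delta>0 by (simp add: m_def)
    then show "\<delta> ^ (2 * k) \<le> 2 * real m" "2 * real m \<le> \<delta> ^ (2 * k) + 2"
      using ceiling_correct[of "\<delta> ^ (2 * k) / 2"] by linarith+
  qed
  define Q where "Q = (diameter T + \<delta>) ^ (2 * k) + 2 * real p + 6"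
  have diam: "0 < diameter T"
  proof -
    obtain z r where r: "0 < r" "cball z r \<subseteq> T"
      using interior_nonempty mem_interior_cball by blast
    have "diameter (cball z r) \<le> diameter T" by (rule diameter_subset[OF r(2) bounded])
    then show ?thesis using r(1) by simp
  qed
  have "\<delta> ^ (2 * k) \<le> (diameter T + \<delta>) ^ (2 * k)"
    using diam \<delta>0 by (intro power_mono) auto
  \<comment> \<open>Twice the left side is at most \<open>\<delta> ^ (2 * k)\<close> + 2p + 4, which
    stays below the bracket \<open>Q\<close> of \<open>c_inv\<close> with its 6.\<close>
  then have "real (p + m + 1) \<le> Q / 2" using m(2) by (simp add: Q_def)
  then have D: "(real (p + m + 1))\<^sup>2 \<le> Q\<^sup>2 / 4"
    using power_mono[of "real (p + m + 1)" "Q / 2" 2] by (simp add: power_divide)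

  obtain c where c: "\<And>x. x \<in> T \<Longrightarrow>
      v x = (\<Sum>\<alpha> | (\<Sum>i\<in>UNIV. \<alpha> i) \<le> p. c \<alpha> * (\<Prod>i\<in>UNIV. (x $ i) ^ \<alpha> i))"
    using assms(5) unfolding poly_on_def by blast
  \<comment> \<open>\<open>v\<close> is known to be polynomial only on \<open>T\<close>;
    \<open>P\<close> is its polynomial extension, continuous and measurable on the whole
    space.\<close>
  define P :: "real^'n \<Rightarrow> real"
    where "P x = (\<Sum>\<alpha> | (\<Sum>i\<in>UNIV. \<alpha> i) \<le> p. c \<alpha> * (\<Prod>i\<in>UNIV. (x $ i) ^ \<alpha> i))" for x
  define f where "f x = (P x)\<^sup>2 * weight k x" for x
  have f0: "0 \<le> f x" for x by (simp add: f_def weight_def)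
  have contf: "continuous_on A f" for A
    using assms(2) unfolding f_def P_def weight_def by (auto intro!: continuous_intros)
  then have [measurable]: "f \<in> borel_measurable borel" by (rule borel_measurable_continuous_onI)
  then have fm: "(\<lambda>x. ennreal (f x)) \<in> borel_measurable borel" by measurable
  have vf: "(v x)\<^sup>2 * weight k x = f x" if "x \<in> T" for x using c[OF that] by (simp add: f_def P_def)
  have [measurable]: "F \<in> sets borel" "T \<in> sets borel" "\<And>i. i < M \<Longrightarrow> G i \<in> sets borel"
    using \<open>closed F\<close> closed G(2) by simp_all
  have [measurable_cong]: "sets (surface_measure F) = sets borel"
    by (simp add: surface_measure_def)

  define I where "I = (LINT x:T|lborel. (v x)\<^sup>2 * weight k x)"
  have I: "I = (LINT x|lborel. indicator T x * f x)"
    unfolding I_def set_lebesgue_integral_def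
    by (intro Bochner_Integration.integral_cong refl) (simp add: vf split: split_indicator)
  have "integrable lborel (\<lambda>x. indicator T x *\<^sub>R f x)"
    using polytope_imp_compact[OF polytope] contf by (rule borel_integrable_compact)
  then have "(\<integral>\<^sup>+x. ennreal (indicator T x * f x) \<partial>lborel) = ennreal I"
    unfolding I by (intro nn_integral_eq_integral) (auto simp: f0)
  moreover have "(\<integral>\<^sup>+x\<in>T. ennreal (f x) \<partial>lborel) = (\<integral>\<^sup>+x. ennreal (indicator T x * f x) \<partial>lborel)"
    by (intro nn_integral_cong) (auto split: split_indicator)
  ultimately have nnI: "(\<integral>\<^sup>+x\<in>T. ennreal (f x) \<partial>lborel) = ennreal I" by simp
  have I0: "0 \<le> I" unfolding I by (intro Bochner_Integration.integral_nonneg) (auto simp: f0)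

  have prism: "(\<integral>\<^sup>+x\<in>G i. ennreal (f x) \<partial>surface_measure F)
      \<le> ennreal ((real (p + m + 1))\<^sup>2 / inradius T) * ennreal I" if i: "i < M" for i
  proof (rule ennreal_le_mult_divide[OF _ \<rho> G(4)[OF i n]])
    show "ennreal \<bar>b i \<bullet> n\<bar> * (\<integral>\<^sup>+x\<in>G i. ennreal (f x) \<partial>surface_measure F)
        \<le> ennreal ((real (p + m + 1))\<^sup>2) * ennreal I"
      unfolding nnI[symmetric] f_def
      by (rule prism_trace[OF P_def assms(2) m(1)[unfolded \<delta>_def] n bn[OF i n]
            closed_prism_subset[OF G(3)[OF i]] refl fm[unfolded f_def]])
  qed simp
  \<comment> \<open>The subfaces cover \<open>F\<close>, so its indicator is at most the sum of
    theirs.\<close>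
  have "(\<integral>\<^sup>+x\<in>F. ennreal (f x) \<partial>surface_measure F)
      \<le> (\<integral>\<^sup>+x. (\<Sum>i<M. ennreal (f x) * indicator (G i) x) \<partial>surface_measure F)"
  proof (rule nn_integral_mono)
    fix x
    show "ennreal (f x) * indicator F x \<le> (\<Sum>i<M. ennreal (f x) * indicator (G i) x)"
    proof (cases "x \<in> F")
      case True
      then obtain i where i: "i < M" "x \<in> G i" using G(1) by blast
      have "ennreal (f x) * indicator (G i) x \<le> (\<Sum>i<M. ennreal (f x) * indicator (G i) x)"
        using i by (intro member_le_sum) auto
      then show ?thesis using True i by simp
    qed simp
  qed
  also have "\<dots> = (\<Sum>i<M. \<integral>\<^sup>+x\<in>G i. ennreal (f x) \<partial>surface_measure F)"
    by (rule nn_integral_sum) measurable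
  also have "\<dots> \<le> (\<Sum>i<M. ennreal ((real (p + m + 1))\<^sup>2 / inradius T) * ennreal I)"
    by (intro sum_mono prism) auto
  also have "\<dots> = ennreal (real M * ((real (p + m + 1))\<^sup>2 / inradius T) * I)"
  proof -
    define D where "D = (real (p + m + 1))\<^sup>2 / inradius T"
    have "0 \<le> D" using \<rho> by (simp add: D_def)
    then show ?thesis unfolding D_def[symmetric]
      using I0 by (simp add: ennreal_mult ennreal_of_nat_eq_real_of_nat mult.assoc)
  qed
  finally have nnF: "(\<integral>\<^sup>+x\<in>F. ennreal (f x) \<partial>surface_measure F)
      \<le> ennreal (real M * ((real (p + m + 1))\<^sup>2 / inradius T) * I)" .

  have "(LINT x:F|surface_measure F. (v x)\<^sup>2 * weight k x) = (LINT x|surface_measure F. indicator F x * f x)"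
    unfolding set_lebesgue_integral_def
    by (intro Bochner_Integration.integral_cong refl)
      (use vf face_subset in \<open>auto split: split_indicator\<close>)
  \<comment> \<open>Returns to the Bochner integral; \<open>nnF\<close> supplies a finite bound, so
    \<open>enn2real\<close> preserves the estimate.\<close>
  also have "\<dots> = enn2real (\<integral>\<^sup>+x. ennreal (indicator F x * f x) \<partial>surface_measure F)"
    by (rule integral_eq_nn_integral) (auto simp: f0)
  also have "(\<integral>\<^sup>+x. ennreal (indicator F x * f x) \<partial>surface_measure F)
      = (\<integral>\<^sup>+x\<in>F. ennreal (f x) \<partial>surface_measure F)"
    by (intro nn_integral_cong) (auto split: split_indicator)
  also have "enn2real \<dots> \<le> real M * ((real (p + m + 1))\<^sup>2 / inradius T) * I"
    using nnF \<rho> I0 by (intro enn2real_leI) auto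
  \<comment> \<open>The sine enters here: 1 / s \<ge> 1 only enlarges the bound.\<close>
  also have "\<dots> \<le> real M * (Q\<^sup>2 / 4 / inradius T / s) * I"
  proof (intro mult_right_mono mult_left_mono I0)
    have "(real (p + m + 1))\<^sup>2 / inradius T \<le> Q\<^sup>2 / 4 / inradius T"
      using D \<rho> by (intro divide_right_mono) auto
    also have "\<dots> \<le> Q\<^sup>2 / 4 / inradius T / s"
      using s \<rho> by (simp add: le_divide_eq mult_left_le)
    finally show "(real (p + m + 1))\<^sup>2 / inradius T \<le> Q\<^sup>2 / 4 / inradius T / s" .
  qed simp
  \<comment> \<open>The factors p^2 and diameter in \<open>c_inv\<close> cancel against p^2 /
    diameter, both being positive.\<close>
  also have "real M * (Q\<^sup>2 / 4 / inradius T / s) = c_inv T F M b p k \<delta> * ((real p)\<^sup>2 / diameter T)"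
    unfolding c_inv_def s_def[symmetric] Q_def[symmetric]
    using diam assms(1) by (simp add: field_simps)
  finally show ?thesis unfolding I_def \<delta>_def .
qed

end
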